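(* Assume (A0)–(A3) as in the context. (i) If $-1<r\le1$ and (M$_p$) holds with some $p>2$, then for any $\varepsilon>0$, a.s., for all but finitely many $t$, $$t^{1/2}(\log t)^{-\frac{4+r}{1+r}-\varepsilon}\le\max_{1\le s\le t}X_s\le t^{1/2}(\log t)^{\frac{3}{1+r}+\varepsilon}.$$ (ii) If $r>1$ and (M$_p$) holds with some $p>1+r$, then for any $\varepsilon>0$, a.s., for all but finitely many $t$, $$t^{\frac{1}{1+r}}(\log t)^{-\frac{1}{1+r}-\varepsilon}\le\max_{1\le s\le t}X_s\le t^{\frac{1}{1+r}}(\log t)^{\frac{2}{1+r}+\varepsilon}.$$
   Context: $\mathbb{N}=\{1,2,\dots\}$. (A0): $\mathbb{S}$ is a locally finite (every bounded set meets it in finitely many points), unbounded subset of $[0,\infty)$ with $0\in\mathbb{S}$; $(X_t)_{t\in\mathbb{N}}$ is an $\mathbb{S}$-valued process adapted to a filtration $(\mathcal{F}_t)_{t\in\mathbb{N}}$ with $\mathbb{P}[X_1=0]=1$. (A1): for each $x,y\in\mathbb{S}$ there exist $m(x,y)\in\mathbb{N}$, $\varphi(x,y)>0$ with $\mathbb{P}[X_{t+m(X_t,y)}=y\mid\mathcal{F}_t]\ge\varphi(X_t,y)$ a.s. for all $t$. Write $\Delta_t:=X_{t+1}-X_t$. (A2): there are $c\in\mathbb{R}$, $s^2\in(0,\infty)$ with, as $X_t\to\infty$, $\mathbb{E}[\Delta_t\mid\mathcal{F}_t]=cX_t^{-1}+o(X_t^{-1}(\log X_t)^{-1})$ and $\mathbb{E}[\Delta_t^2\mid\mathcal{F}_t]=s^2+o((\log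 X_t)^{-1})$ a.s., where the implicit constants in $o(\cdot)$ are non-random and uniform in $t$ and in the sample point. Set $r:=-2c/s^2$. Excursions: $\tau_0:=1$, $\tau_n:=\min\{t>\tau_{n-1}:X_t=0\}$ ($\min\emptyset=\infty$), $\eta_n:=\tau_n-\tau_{n-1}$, $\mathcal{E}_n:=(X_t)_{\tau_{n-1}\le t\le\tau_n-1}$, $N:=\min\{n\in\mathbb{N}:\tau_n=\infty\}$. (A3): (a) on $\{N=\infty\}$, $(\mathcal{E}_n)_{n\in\mathbb{N}}$ is i.i.d.; (b) $\mathbb{P}[\eta_{n+1}<\infty\mid\tau_n<\infty]=\mathbb{P}[\eta_1<\infty]$ for all $n$. (M$_p$): there exist $\delta>0$, $C<\infty$ with $\mathbb{E}[|\Delta_t|^p\mid\mathcal{F}_t]\le C(1+X_t)^{p-2-\delta}$ a.s. for all $t$. *)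

theory Defs
  imports "HOL-Probability.Probability" "HOL-Library.Landau_Symbols"
begin

fun tau :: "(nat \<Rightarrow> 'a \<Rightarrow> real) \<Rightarrow> nat \<Rightarrow> 'a \<Rightarrow> enat" where
  "tau X 0 \<omega> = enat 1"
| "tau X (Suc n) \<omega> =
     (case tau X n \<omega> of
        \<infinity> \<Rightarrow> \<infinity>
      | enat k \<Rightarrow> (if \<exists>t>k. X t \<omega> = 0 then enat (LEAST t. t > k \<and> X t \<omega> = 0) else \<infinity>))"

definition eta :: "(nat \<Rightarrow> 'a \<Rightarrow> real) \<Rightarrow> nat \<Rightarrow> 'a \<Rightarrow> enat" where
  "eta X n \<omega> = tau X n \<omega> - tau X (n - 1) \<omega>"

text \<open>The n-th excursion (n >= 1), (X_t) for tau(n-1) <= t <= tau n - 1, encoded as a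
  sequence k \<mapsto> X (tau (n-1) + k) for k < eta n, padded by the value -1 (which is not in
  the state space S \<subseteq> [0,\<infinity>)) for k >= eta n, so that the length is recorded too.\<close>
definition excursion :: "(nat \<Rightarrow> 'a \<Rightarrow> real) \<Rightarrow> nat \<Rightarrow> 'a \<Rightarrow> nat \<Rightarrow> real" where
  "excursion X n \<omega> = (\<lambda>k. if enat k < eta X n \<omega>
                            then X (the_enat (tau X (n - 1) \<omega>) + k) \<omega> else -1)"

definition all_excursions_finite :: "'a measure \<Rightarrow> (nat \<Rightarrow> 'a \<Rightarrow> real) \<Rightarrow> 'a set" where
  "all_excursions_finite M X = {\<omega> \<in> space M. \<forall>n. tau X n \<omega> \<noteq> \<infinity>}"

definition moment_cond :: "'a measure \<Rightarrow> (nat \<Rightarrow> 'a measure) \<Rightarrow> (nat \<Rightarrow> 'a \<Rightarrow> real) \<Rightarrow> real \<Rightarrow> bool" where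
  "moment_cond M F X p \<longleftrightarrow>
     (\<exists>\<delta>>0. \<exists>C::real. \<forall>t\<ge>1. AE \<omega> in M.
        nn_cond_exp M (F t) (\<lambda>\<omega>. ennreal (\<bar>X (t+1) \<omega> - X t \<omega>\<bar> powr p)) \<omega>
          \<le> ennreal (C * (1 + X t \<omega>) powr (p - 2 - \<delta>)))"

end

theory Submission
  imports Defs "HOL-Real_Asymp.Real_Asymp"
begin

text \<open>
  The bounds come from Lyapunov functions.  Put $a = \max(2, 1+r)$ and $g(x) = x^a (\log x)^b$.  Up to lower order terms, the
  conditional drift of $g(X_t)$ at $X_t = x$ is
  $(s^2/2) x^{a-2} (\log x)^{b-1} (a(a-1-r) \log x + b(2a-1-r))$.

  For $b = -1$ it is bounded above, so the maximal inequality gives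
  $P(\max_{s \le n} X_s \ge R) = O(n / g(R))$.  For $b = 1$ (if $r \le 1$) or any small $b > 0$
  (if $r > 1$) it is bounded away from zero at large $x$, so before exceeding $R$ the process
  spends an expected time $O(g(2R))$ away from the origin; by irreducibility the time spent near
  the origin is of the same order, whence $P(\max_{s \le n} X_s < R) = O(g(2R) / n)$.
  Borel-Cantelli along $n = 2^j$ concludes.
\<close>

section \<open>Powers times logarithms\<close>

definition plog :: "real \<Rightarrow> real \<Rightarrow> real \<Rightarrow> real" where
  "plog a b x = x powr a * ln x powr b"

definition plog1 :: "real \<Rightarrow> real \<Rightarrow> real \<Rightarrow> real" where
  "plog1 a b x = a * plog (a - 1) b x + b * plog (a - 1) (b - 1) x"

definition plog2 :: "real \<Rightarrow> real \<Rightarrow> real \<Rightarrow> real" where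
  "plog2 a b x = a * plog1 (a - 1) b x + b * plog1 (a - 1) (b - 1) x"

definition plog3 :: "real \<Rightarrow> real \<Rightarrow> real \<Rightarrow> real" where
  "plog3 a b x = a * plog2 (a - 1) b x + b * plog2 (a - 1) (b - 1) x"

lemma measurable_plog [measurable]: "plog a b \<in> borel_measurable borel"
  unfolding plog_def by measurable

lemma measurable_plog1 [measurable]: "plog1 a b \<in> borel_measurable borel"
  unfolding plog1_def by measurable

lemma measurable_plog2 [measurable]: "plog2 a b \<in> borel_measurable borel"
  unfolding plog2_def by measurable

lemma plog_nonneg: "0 \<le> plog a b x"
  by (simp add: plog_def)

lemma DERIV_plog: "(plog a b has_real_derivative plog1 a b x) (at x)" if "x > 1"
proof -
  have "((\<lambda>x. x powr a * ln x powr b) has_real_derivative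
      (a * x powr (a - 1)) * ln x powr b + (b * ln x powr (b - 1) * (1 / x)) * x powr a) (at x)"
    using that
    by (auto intro!: derivative_eq_intros simp: powr_diff field_simps)
  moreover have "x powr (a - 1) = x powr a / x"
    using that by (simp add: powr_diff)
  ultimately show ?thesis
    by (simp add: plog_def[abs_def] plog1_def field_simps)
qed

lemma DERIV_plog1: "(plog1 a b has_real_derivative plog2 a b x) (at x)" if "x > 1"
  unfolding plog1_def[of a b, abs_def] plog2_def
  by (intro derivative_intros DERIV_cmult DERIV_plog that)

lemma DERIV_plog2: "(plog2 a b has_real_derivative plog3 a b x) (at x)" if "x > 1"
  unfolding plog2_def[of a b, abs_def] plog3_def
  by (intro derivative_intros DERIV_cmult DERIV_plog1 that)

lemma plog_shift_le:
  assumes "\<eta> > 0"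
  shows "eventually (\<lambda>x. \<bar>plog a b x\<bar> \<le> x powr (a + \<eta>)) at_top"
    and "eventually (\<lambda>x. \<bar>plog1 a b x\<bar> \<le> x powr (a - 1 + \<eta>)) at_top"
    and "eventually (\<lambda>x. \<bar>plog2 a b x\<bar> \<le> x powr (a - 2 + \<eta>)) at_top"
    and "eventually (\<lambda>x. \<bar>plog3 a b x\<bar> \<le> x powr (a - 3 + \<eta>)) at_top"
proof -
  have *: "(\<lambda>x. plog a b x) \<in> o(\<lambda>x. x powr (a' + \<eta>))" if "a' = a" for a b a'
    unfolding that plog_def using assms by real_asymp
  have 1: "(\<lambda>x. plog1 a b x) \<in> o(\<lambda>x. x powr (a' + \<eta>))" if "a' = a - 1" for a b a'
    unfolding plog1_def by (intro sum_in_smallo cmult_in_smallo_iff[THEN iffD2] disjI2 *) (use that in auto)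
  have 2: "(\<lambda>x. plog2 a b x) \<in> o(\<lambda>x. x powr (a' + \<eta>))" if "a' = a - 2" for a b a'
    unfolding plog2_def by (intro sum_in_smallo cmult_in_smallo_iff[THEN iffD2] disjI2 1) (use that in auto)
  have 3: "(\<lambda>x. plog3 a b x) \<in> o(\<lambda>x. x powr (a' + \<eta>))" if "a' = a - 3" for a b a'
    unfolding plog3_def by (intro sum_in_smallo cmult_in_smallo_iff[THEN iffD2] disjI2 2) (use that in auto)
  show "eventually (\<lambda>x. \<bar>plog a b x\<bar> \<le> x powr (a + \<eta>)) at_top"
    using landau_o.smallD[OF *[of a a b], of 1] by simp
  show "eventually (\<lambda>x. \<bar>plog1 a b x\<bar> \<le> x powr (a - 1 + \<eta>)) at_top"
    using landau_o.smallD[OF 1[of "a-1" a b], of 1] by simp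
  show "eventually (\<lambda>x. \<bar>plog2 a b x\<bar> \<le> x powr (a - 2 + \<eta>)) at_top"
    using landau_o.smallD[OF 2[of "a-2" a b], of 1] by simp
  show "eventually (\<lambda>x. \<bar>plog3 a b x\<bar> \<le> x powr (a - 3 + \<eta>)) at_top"
    using landau_o.smallD[OF 3[of "a-3" a b], of 1] by simp
qed

lemma powr_comparable:
  fixes x y e :: real
  assumes "x > 0" "x / 2 \<le> y" "y \<le> 2 * x"
  shows "y powr e \<le> 2 powr \<bar>e\<bar> * x powr e"
proof (cases "e \<ge> 0")
  case True
  have "y powr e \<le> (2 * x) powr e" using assms True by (intro powr_mono2) auto
  then show ?thesis using assms True by (simp add: powr_mult)
next
  case False
  have "y powr e \<le> (x / 2) powr e" using assms False by (intro powr_mono2') auto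
  also have "\<dots> = 2 powr (- e) * x powr e"
    using assms by (simp add: powr_divide powr_minus field_simps)
  finally show ?thesis using False by simp
qed

lemma powr_add_le:
  fixes y z a :: real
  assumes "y \<ge> 0" "z \<ge> 0" "a \<ge> 0"
  shows "(y + z) powr a \<le> 2 powr a * (y powr a + z powr a)"
proof -
  have "(y + z) powr a \<le> (2 * max y z) powr a"
    using assms by (intro powr_mono2) auto
  also have "\<dots> = 2 powr a * max y z powr a"
    using assms by (intro powr_mult)
  also have "\<dots> \<le> 2 powr a * (y powr a + z powr a)"
    by (intro mult_left_mono) (auto simp: max_def)
  finally show ?thesis .
qed

lemma powr_le_one_add_powr:
  fixes y q p :: real
  assumes "0 \<le> y" "0 \<le> q" "q \<le> p"
  shows "y powr q \<le> 1 + y powr p"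
proof (cases "y \<le> 1")
  case True
  then have "y powr q \<le> 1 powr q" using assms by (intro powr_mono2) auto
  then show ?thesis by (simp add: add_increasing2)
next
  case False
  then have "y powr q \<le> y powr p" using assms by (intro powr_mono) auto
  then show ?thesis by simp
qed

lemma plog_Taylor_small:
  assumes "\<gamma> > 0"
  shows "eventually (\<lambda>x. \<forall>h. \<bar>h\<bar> \<le> x powr (1 - \<gamma>) \<longrightarrow>
      \<bar>plog a b (x + h) - plog a b x - plog1 a b x * h - plog2 a b x / 2 * h\<^sup>2\<bar>
        \<le> 2 powr \<bar>a - 3 + \<gamma> / 2\<bar> * x powr (a - 2 - \<gamma> / 2) * h\<^sup>2) at_top"
proof -
  obtain Y where Y: "\<And>y. y \<ge> Y \<Longrightarrow> \<bar>plog3 a b y\<bar> \<le> y powr (a - 3 + \<gamma> / 2)"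
    using plog_shift_le(4)[of "\<gamma>/2" a b] assms by (auto simp: eventually_at_top_linorder)
  have "eventually (\<lambda>x. x powr (1 - \<gamma>) \<le> x / 2) at_top"
    using assms by real_asymp
  moreover have "eventually (\<lambda>x::real. x > 2 \<and> x \<ge> 2 * Y) at_top"
    by (intro eventually_conj eventually_gt_at_top eventually_ge_at_top)
  ultimately show ?thesis
  proof eventually_elim
    case (elim x)
    show ?case
    proof (intro allI impI)
      fix h :: real assume h: "\<bar>h\<bar> \<le> x powr (1 - \<gamma>)"
      have hx: "\<bar>h\<bar> \<le> x / 2" using h elim by linarith
      show "\<bar>plog a b (x + h) - plog a b x - plog1 a b x * h - plog2 a b x / 2 * h\<^sup>2\<bar>
        \<le> 2 powr \<bar>a - 3 + \<gamma> / 2\<bar> * x powr (a - 2 - \<gamma> / 2) * h\<^sup>2"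
      proof (cases "h = 0")
        case True then show ?thesis by simp
      next
        case False
        define diff where "diff m = (if m = 0 then plog a b else if m = 1 then plog1 a b
          else if m = 2 then plog2 a b else plog3 a b)" for m :: nat
        have "\<forall>m t. m < 3 \<and> x / 2 \<le> t \<and> t \<le> 3 * x / 2 \<longrightarrow> DERIV (diff m) t :> diff (Suc m) t"
          using elim by (auto simp: diff_def less_Suc_eq numeral_3_eq_3 numeral_2_eq_2
              intro!: DERIV_plog DERIV_plog1 DERIV_plog2)
        then have "\<exists>t. (if x + h < x then x + h < t \<and> t < x else x < t \<and> t < x + h) \<and>
            plog a b (x + h) = (\<Sum>m<3. diff m x / fact m * (x + h - x) ^ m) + diff 3 t / fact 3 * (x + h - x) ^ 3"
          using hx False elim by (intro Taylor[where a="x / 2" and b="3 * x / 2"]) (auto simp: diff_def)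
        then obtain t where t: "if x + h < x then x + h < t \<and> t < x else x < t \<and> t < x + h"
          and eq: "plog a b (x + h) = (\<Sum>m<3. diff m x / fact m * h ^ m) + diff 3 t / fact 3 * h ^ 3"
          by auto
        have tx: "x / 2 \<le> t" "t \<le> 2 * x" using t hx elim by (auto split: if_splits)
        have "\<bar>plog a b (x + h) - plog a b x - plog1 a b x * h - plog2 a b x / 2 * h\<^sup>2\<bar>
            = \<bar>plog3 a b t\<bar> / 6 * \<bar>h\<bar> ^ 3"
          by (simp add: eq diff_def numeral_3_eq_3 abs_mult power_abs fact_numeral power2_eq_square)
        also have "\<dots> \<le> (2 powr \<bar>a - 3 + \<gamma> / 2\<bar> * x powr (a - 3 + \<gamma> / 2)) * (\<bar>h\<bar> * h\<^sup>2)"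
        proof (intro mult_mono)
          have "\<bar>plog3 a b t\<bar> \<le> t powr (a - 3 + \<gamma> / 2)" using Y[of t] tx elim by simp
          also have "\<dots> \<le> 2 powr \<bar>a - 3 + \<gamma> / 2\<bar> * x powr (a - 3 + \<gamma> / 2)"
            using tx elim by (intro powr_comparable) auto
          finally show "\<bar>plog3 a b t\<bar> / 6 \<le> 2 powr \<bar>a - 3 + \<gamma> / 2\<bar> * x powr (a - 3 + \<gamma> / 2)" by simp
        qed (auto simp: power3_eq_cube power2_eq_square)
        also have "\<dots> \<le> (2 powr \<bar>a - 3 + \<gamma> / 2\<bar> * x powr (a - 3 + \<gamma> / 2)) * (x powr (1 - \<gamma>) * h\<^sup>2)"
          using h by (intro mult_left_mono mult_right_mono) auto
        also have "\<dots> = 2 powr \<bar>a - 3 + \<gamma> / 2\<bar> * (x powr (a - 3 + \<gamma> / 2) * x powr (1 - \<gamma>)) * h\<^sup>2"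
          by simp
        also have "x powr (a - 3 + \<gamma> / 2) * x powr (1 - \<gamma>) = x powr (a - 2 - \<gamma> / 2)"
          unfolding powr_add[symmetric] by (rule arg_cong[where f="(powr) x"]) simp
        finally show ?thesis .
      qed
    qed
  qed
qed

lemma abs_powr_le_moment:
  fixes x h :: real
  assumes "x > 0" "\<bar>h\<bar> > x powr (1 - \<gamma>)" "q \<le> p"
  shows "\<bar>h\<bar> powr q \<le> x powr (- (1 - \<gamma>) * (p - q)) * \<bar>h\<bar> powr p"
proof -
  have "0 < x powr (1 - \<gamma>)" using assms by simp
  then have h: "\<bar>h\<bar> > 0" using assms by linarith
  have "\<bar>h\<bar> powr q = \<bar>h\<bar> powr (- (p - q)) * \<bar>h\<bar> powr p"
    by (simp add: powr_add[symmetric])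
  also have "\<dots> \<le> (x powr (1 - \<gamma>)) powr (- (p - q)) * \<bar>h\<bar> powr p"
    using assms h by (intro mult_right_mono powr_mono2') auto
  also have "(x powr (1 - \<gamma>)) powr (- (p - q)) = x powr (- (1 - \<gamma>) * (p - q))"
    unfolding powr_powr by (rule arg_cong[where f="(powr) x"]) (simp add: algebra_simps)
  finally show ?thesis .
qed

lemma weighted_abs_powr_le_moment:
  fixes x h z :: real
  assumes "x \<ge> 1" "\<bar>h\<bar> > x powr (1 - \<gamma>)" "0 \<le> q" "q \<le> p" "0 < \<gamma>" "\<bar>z\<bar> \<le> x powr (a - q + \<gamma> / 2)"
  shows "\<bar>z\<bar> * \<bar>h\<bar> powr q \<le> x powr (a - p + (p + 1) * \<gamma>) * \<bar>h\<bar> powr p"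
proof -
  have "\<bar>z\<bar> * \<bar>h\<bar> powr q \<le> x powr (a - q + \<gamma> / 2) * (x powr (- (1 - \<gamma>) * (p - q)) * \<bar>h\<bar> powr p)"
    using assms by (intro mult_mono abs_powr_le_moment) auto
  also have "\<dots> = x powr (a - p + \<gamma> / 2 + \<gamma> * (p - q)) * \<bar>h\<bar> powr p"
  proof -
    have "a - q + \<gamma> / 2 + - (1 - \<gamma>) * (p - q) = a - p + \<gamma> / 2 + \<gamma> * (p - q)"
      by (simp add: algebra_simps)
    then show ?thesis by (metis mult.assoc powr_add)
  qed
  also have "\<dots> \<le> x powr (a - p + (p + 1) * \<gamma>) * \<bar>h\<bar> powr p"
    using assms by (intro mult_right_mono powr_mono) (auto simp: algebra_simps)
  finally show ?thesis .
qed

lemma plog_large: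
  assumes "\<gamma> > 0" "p > 2"
  shows "eventually (\<lambda>x. \<forall>h. \<bar>h\<bar> > x powr (1 - \<gamma>) \<longrightarrow>
      plog a b x + \<bar>plog1 a b x * h\<bar> + \<bar>plog2 a b x / 2 * h\<^sup>2\<bar>
        \<le> 3 * x powr (a - p + (p + 1) * \<gamma>) * \<bar>h\<bar> powr p) at_top"
proof -
  have "\<gamma> / 2 > 0" using assms by simp
  from plog_shift_le(1-3)[OF this, of a b] eventually_ge_at_top[of "1::real"] show ?thesis
  proof eventually_elim
    case (elim x)
    show ?case
    proof (intro allI impI)
      fix h :: real assume h: "\<bar>h\<bar> > x powr (1 - \<gamma>)"
      have "0 < x powr (1 - \<gamma>)" using elim by simp
      then have h0: "\<bar>h\<bar> > 0" using h by linarith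
      note * = weighted_abs_powr_le_moment[OF _ h _ _ \<open>\<gamma> > 0\<close>, of _ p _ a]
      have "\<bar>plog a b x\<bar> * \<bar>h\<bar> powr 0 \<le> x powr (a - p + (p + 1) * \<gamma>) * \<bar>h\<bar> powr p"
        using elim assms by (intro *) auto
      moreover have "\<bar>plog1 a b x\<bar> * \<bar>h\<bar> powr 1 \<le> x powr (a - p + (p + 1) * \<gamma>) * \<bar>h\<bar> powr p"
        using elim assms by (intro *) auto
      moreover have "\<bar>plog2 a b x\<bar> * \<bar>h\<bar> powr 2 \<le> x powr (a - p + (p + 1) * \<gamma>) * \<bar>h\<bar> powr p"
        using elim assms by (intro *) auto
      moreover have "\<bar>plog2 a b x / 2 * h\<^sup>2\<bar> \<le> \<bar>plog2 a b x\<bar> * \<bar>h\<bar> powr 2"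
        using h0 by (simp add: abs_mult)
      moreover have "plog a b x \<le> \<bar>plog a b x\<bar>" by simp
      ultimately show "plog a b x + \<bar>plog1 a b x * h\<bar> + \<bar>plog2 a b x / 2 * h\<^sup>2\<bar>
        \<le> 3 * x powr (a - p + (p + 1) * \<gamma>) * \<bar>h\<bar> powr p"
        using h0 unfolding abs_mult[of "plog1 a b x" h] by (simp del: abs_divide)
    qed
  qed
qed

lemma drift_main_term:
  assumes "s2 > 0" "x > 1"
  shows "plog1 a b x * (c / x) + plog2 a b x / 2 * s2 =
     s2 / 2 * (a * (a - 1 + 2 * c / s2) * plog (a - 2) b x + b * (2 * a - 1 + 2 * c / s2) * plog (a - 2) (b - 1) x
               + b * (b - 1) * plog (a - 2) (b - 2) x)"
proof -
  have *: "plog (a - 1) b x / x = plog (a - 2) b x" for b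
    using assms by (simp add: plog_def powr_diff field_simps power2_eq_square)
  have "plog1 a b x * (c / x) = c * (a * (plog (a - 1) b x / x) + b * (plog (a - 1) (b - 1) x / x))"
    using assms by (simp add: plog1_def field_simps)
  also have "\<dots> = c * (a * plog (a - 2) b x + b * plog (a - 2) (b - 1) x)"
    by (simp only: *)
  finally have 1: "plog1 a b x * (c / x) = c * (a * plog (a - 2) b x + b * plog (a - 2) (b - 1) x)" .
  show ?thesis unfolding 1 unfolding plog2_def plog1_def
    using assms by (simp add: field_simps)
qed

lemma drift_error_smallo:
  assumes "h1 \<in> o[at_top](\<lambda>x::real. 1 / (x * ln x))" "h2 \<in> o[at_top](\<lambda>x::real. 1 / ln x)"
    and "\<gamma> > 0" "\<delta> > 0"
  shows "(\<lambda>x. \<bar>plog1 a b x\<bar> * \<bar>h1 x\<bar> + (\<bar>plog2 a b x\<bar> + K * x powr (a - 2 - \<gamma>)) * \<bar>h2 x\<bar>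
      + K * x powr (a - 2 - \<gamma>) * s2 + L * x powr (a - 2 - \<delta>)) \<in> o(\<lambda>x. plog (a - 2) (b - 1) x)"
proof -
  have "(\<lambda>x. plog1 a b x) \<in> O(\<lambda>x. plog (a - 1) b x)"
    unfolding plog1_def plog_def by real_asymp
  then have "(\<lambda>x. \<bar>plog1 a b x\<bar>  * \<bar>h1 x\<bar>) \<in> o(\<lambda>x. plog (a - 1) b x * (1 / (x * ln x)))"
    using assms(1) by (intro landau_o.big_small_mult) auto
  also have "(\<lambda>x. plog (a - 1) b x * (1 / (x * ln x))) \<in> O(\<lambda>x. plog (a - 2) (b - 1) x)"
    unfolding plog_def by real_asymp
  finally have 1: "(\<lambda>x. \<bar>plog1 a b x\<bar> * \<bar>h1 x\<bar>) \<in> o(\<lambda>x. plog (a - 2) (b - 1) x)" .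
  have "(\<lambda>x. \<bar>plog2 a b x\<bar> + K * x powr (a - 2 - \<gamma>)) \<in> O(\<lambda>x. plog (a - 2) b x)"
  proof (rule sum_in_bigo)
    have "(\<lambda>x. plog2 a b x) \<in> O(\<lambda>x. plog (a - 2) b x)"
      unfolding plog2_def plog1_def plog_def by real_asymp
    then show "(\<lambda>x. \<bar>plog2 a b x\<bar>) \<in> O(\<lambda>x. plog (a - 2) b x)" by simp
    show "(\<lambda>x. K * x powr (a - 2 - \<gamma>)) \<in> O(\<lambda>x. plog (a - 2) b x)"
      unfolding plog_def using assms(3) by real_asymp
  qed
  then have "(\<lambda>x. (\<bar>plog2 a b x\<bar> + K * x powr (a - 2 - \<gamma>)) * \<bar>h2 x\<bar>) \<in> o(\<lambda>x. plog (a - 2) b x * (1 / ln x))"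
    using assms(2) by (intro landau_o.big_small_mult) auto
  also have "(\<lambda>x. plog (a - 2) b x * (1 / ln x)) \<in> O(\<lambda>x. plog (a - 2) (b - 1) x)"
    unfolding plog_def by real_asymp
  finally have 2: "(\<lambda>x. (\<bar>plog2 a b x\<bar> + K * x powr (a - 2 - \<gamma>)) * \<bar>h2 x\<bar>) \<in> o(\<lambda>x. plog (a - 2) (b - 1) x)" .
  have 3: "(\<lambda>x. K * x powr (a - 2 - \<gamma>) * s2) \<in> o(\<lambda>x. plog (a - 2) (b - 1) x)"
    unfolding plog_def using assms(3) by real_asymp
  have 4: "(\<lambda>x. L * x powr (a - 2 - \<delta>)) \<in> o(\<lambda>x. plog (a - 2) (b - 1) x)"
    unfolding plog_def using assms(4) by real_asymp
  show ?thesis by (intro sum_in_smallo 1 2 3 4)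
qed

section \<open>Test functions\<close>

lemma drift_estimate:
  assumes "h1 \<in> o[at_top](\<lambda>x::real. 1 / (x * ln x))" "h2 \<in> o[at_top](\<lambda>x::real. 1 / ln x)"
    and "\<gamma> > 0" "\<delta> > 0" "K \<ge> 0" "W \<ge> 0" "C \<ge> 0" "\<theta> > 0" "s2 > 0"
  shows "eventually (\<lambda>x. \<forall>\<mu> \<sigma>. \<bar>\<mu> - c / x\<bar> \<le> \<bar>h1 x\<bar> \<longrightarrow> \<bar>\<sigma> - s2\<bar> \<le> \<bar>h2 x\<bar> \<longrightarrow>
     \<bar>plog1 a b x * \<mu> + plog2 a b x / 2 * \<sigma> - (plog1 a b x * (c / x) + plog2 a b x / 2 * s2)\<bar>
       + K * x powr (a - 2 - \<gamma>) * \<bar>\<sigma>\<bar>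
       + W * x powr (a - p + \<delta> / 2) * (C * (1 + x) powr (p - 2 - \<delta>))
     \<le> \<theta> * plog (a - 2) (b - 1) x) at_top"
proof -
  define L where "L = W * C * 2 powr \<bar>p - 2 - \<delta>\<bar>"
  have "\<delta> / 2 > 0" using assms by simp
  from landau_o.smallD[OF drift_error_smallo[OF assms(1-3) this, of a b K s2 L] \<open>\<theta> > 0\<close>]
  have "eventually (\<lambda>x. \<bar>\<bar>plog1 a b x\<bar> * \<bar>h1 x\<bar> + (\<bar>plog2 a b x\<bar> + K * x powr (a - 2 - \<gamma>)) * \<bar>h2 x\<bar>
      + K * x powr (a - 2 - \<gamma>) * s2 + L * x powr (a - 2 - \<delta> / 2)\<bar> \<le> \<theta> * \<bar>plog (a - 2) (b - 1) x\<bar>) at_top"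
    by (simp only: real_norm_def)
  with eventually_ge_at_top[of "1::real"] show ?thesis
  proof eventually_elim
    case (elim x)
    show ?case
    proof (intro allI impI)
      fix \<mu> \<sigma> :: real assume m: "\<bar>\<mu> - c / x\<bar> \<le> \<bar>h1 x\<bar>" and s: "\<bar>\<sigma> - s2\<bar> \<le> \<bar>h2 x\<bar>"
      have "plog1 a b x * \<mu> + plog2 a b x / 2 * \<sigma> - (plog1 a b x * (c / x) + plog2 a b x / 2 * s2)
          = plog1 a b x * (\<mu> - c / x) + plog2 a b x / 2 * (\<sigma> - s2)"
        by (simp only: right_diff_distrib)
      also have "\<bar>\<dots>\<bar> \<le> \<bar>plog1 a b x\<bar> * \<bar>\<mu> - c / x\<bar> + \<bar>plog2 a b x\<bar> * \<bar>\<sigma> - s2\<bar>"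
        by (rule order_trans[OF abs_triangle_ineq]) (simp add: abs_mult)
      also have "\<dots> \<le> \<bar>plog1 a b x\<bar> * \<bar>h1 x\<bar> + \<bar>plog2 a b x\<bar> * \<bar>h2 x\<bar>"
        using m s by (intro add_mono mult_left_mono) auto
      finally have 1: "\<bar>plog1 a b x * \<mu> + plog2 a b x / 2 * \<sigma> - (plog1 a b x * (c / x) + plog2 a b x / 2 * s2)\<bar>
        \<le> \<bar>plog1 a b x\<bar> * \<bar>h1 x\<bar> + \<bar>plog2 a b x\<bar> * \<bar>h2 x\<bar>" .
      have "\<bar>\<sigma>\<bar> \<le> \<bar>h2 x\<bar> + s2" using s assms by linarith
      then have 2: "K * x powr (a - 2 - \<gamma>) * \<bar>\<sigma>\<bar> \<le> K * x powr (a - 2 - \<gamma>) * (\<bar>h2 x\<bar> + s2)"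
        using assms by (intro mult_left_mono) auto
      have "W * x powr (a - p + \<delta> / 2) * (C * (1 + x) powr (p - 2 - \<delta>))
          \<le> W * x powr (a - p + \<delta> / 2) * (C * (2 powr \<bar>p - 2 - \<delta>\<bar> * x powr (p - 2 - \<delta>)))"
        using assms elim by (intro mult_left_mono powr_comparable) auto
      also have "\<dots> = L * (x powr (a - p + \<delta> / 2) * x powr (p - 2 - \<delta>))"
        by (simp add: L_def)
      also have "x powr (a - p + \<delta> / 2) * x powr (p - 2 - \<delta>) = x powr (a - 2 - \<delta> / 2)"
        unfolding powr_add[symmetric] by (rule arg_cong[where f="(powr) x"]) (simp add: field_simps)
      finally have 3: "W * x powr (a - p + \<delta> / 2) * (C * (1 + x) powr (p - 2 - \<delta>)) \<le> L * x powr (a - 2 - \<delta> / 2)" .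
      have 4: "\<bar>plog (a - 2) (b - 1) x\<bar> = plog (a - 2) (b - 1) x" using plog_nonneg by simp
      show "\<bar>plog1 a b x * \<mu> + plog2 a b x / 2 * \<sigma> - (plog1 a b x * (c / x) + plog2 a b x / 2 * s2)\<bar>
       + K * x powr (a - 2 - \<gamma>) * \<bar>\<sigma>\<bar>
       + W * x powr (a - p + \<delta> / 2) * (C * (1 + x) powr (p - 2 - \<delta>)) \<le> \<theta> * plog (a - 2) (b - 1) x"
        using 1 2 3 elim(2) unfolding 4 distrib_left distrib_right by linarith
    qed
  qed
qed

text \<open>Vanishing below A makes the drift nonnegative there whatever the process does near the
  origin; the cap at level 2R bounds the overshoot when X leaves [0, R).\<close>
definition trunc_plog :: "real \<Rightarrow> real \<Rightarrow> real \<Rightarrow> real \<Rightarrow> real \<Rightarrow> real" where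
  "trunc_plog a b A R y = (if y < A then 0 else plog a b (min y (2 * R)) - plog a b A)"

lemma measurable_trunc_plog [measurable]: "trunc_plog a b A R \<in> borel_measurable borel"
  unfolding trunc_plog_def by measurable

lemma plog_mono:
  assumes "a \<ge> 0" "b \<ge> 0" "1 \<le> x" "x \<le> y"
  shows "plog a b x \<le> plog a b y"
  unfolding plog_def using assms by (intro mult_mono powr_mono2) auto

lemma plog_mono_eventually:
  assumes "a > 0"
  obtains Y where "Y \<ge> Y0" "\<And>x y. Y \<le> x \<Longrightarrow> x \<le> y \<Longrightarrow> plog a b x \<le> plog a b y"
proof -
  have "eventually (\<lambda>x. 0 \<le> plog1 a b x) at_top"
    unfolding plog1_def plog_def using assms by real_asymp
  then obtain Y where Y: "\<And>x. x \<ge> Y \<Longrightarrow> 0 \<le> plog1 a b x"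
    by (auto simp: eventually_at_top_linorder)
  show ?thesis
  proof (rule that[of "max (max Y Y0) 2"])
    fix x y assume xy: "max (max Y Y0) 2 \<le> x" "x \<le> y"
    show "plog a b x \<le> plog a b y"
    proof (rule DERIV_nonneg_imp_nondecreasing[OF xy(2)])
      fix z assume "x \<le> z" "z \<le> y"
      then have "z > 1" "z \<ge> Y" using xy by auto
      then show "\<exists>y. (plog a b has_real_derivative y) (at z) \<and> 0 \<le> y"
        using DERIV_plog Y by blast
    qed
  qed simp
qed

lemma trunc_plog_bounds:
  assumes "a \<ge> 0" "b \<ge> 0" "1 \<le> A" "A \<le> R"
  shows "0 \<le> trunc_plog a b A R y" "trunc_plog a b A R y \<le> plog a b (2 * R)"
proof -
  show "0 \<le> trunc_plog a b A R y"
    using plog_mono[of a b A "min y (2 * R)"] assms by (auto simp: trunc_plog_def)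
  show "trunc_plog a b A R y \<le> plog a b (2 * R)"
    using plog_mono[of a b "min y (2 * R)" "2 * R"] assms plog_nonneg[of a b A] plog_nonneg[of a b "2 * R"]
    by (auto simp: trunc_plog_def)
qed

lemma lower_test_function:
  assumes h: "h1 \<in> o[at_top](\<lambda>x::real. 1 / (x * ln x))" "h2 \<in> o[at_top](\<lambda>x::real. 1 / ln x)"
    and "\<delta> > 0" "C \<ge> 0" "s2 > 0" "p > 2" "2 \<le> a" "1 - 2 * c / s2 \<le> a" "b > 0" "2 < a \<or> b = 1"
  obtains A \<kappa> u v w where "A \<ge> A0" "A > 1" "\<kappa> > 0"
    "u \<in> borel_measurable borel" "v \<in> borel_measurable borel" "w \<in> borel_measurable borel"
    "\<And>x. w x \<ge> (0::real)"
    "\<And>x h R. A \<le> x \<Longrightarrow> x < R \<Longrightarrow> u x * h + v x * h\<^sup>2 - w x * \<bar>h\<bar> powr p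
        \<le> trunc_plog a b A R (x + h) - trunc_plog a b A R x"
    "\<And>x \<mu> \<sigma>. A \<le> x \<Longrightarrow> \<bar>\<mu> - c / x\<bar> \<le> \<bar>h1 x\<bar> \<Longrightarrow> \<bar>\<sigma> - s2\<bar> \<le> \<bar>h2 x\<bar> \<Longrightarrow>
        \<kappa> \<le> u x * \<mu> + v x * \<sigma> - w x * (C * (1 + x) powr (p - 2 - \<delta>))"
proof -
  define \<gamma> where "\<gamma> = \<delta> / (2 * (p + 1))"
  have g: "\<gamma> > 0" "(p + 1) * \<gamma> = \<delta> / 2" using assms by (auto simp: \<gamma>_def field_simps)
  then have g2: "\<gamma> / 2 > 0" by simp
  define K where "K = 2 powr \<bar>a - 3 + \<gamma> / 2\<bar>"
  have K: "K \<ge> 0" by (simp add: K_def)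
  define \<beta> where "\<beta> = b * (2 * a - 1 + 2 * c / s2)"
  have "2 * a - 1 + 2 * c / s2 > 0" using assms by linarith
  then have \<beta>: "\<beta> > 0" using assms by (simp add: \<beta>_def)
  define \<kappa> where "\<kappa> = s2 * \<beta> / 8"
  have \<kappa>: "\<kappa> > 0" using \<beta> assms by (simp add: \<kappa>_def mult_ac)
  define P where "P x \<longleftrightarrow> x \<ge> A0 \<and> x > 2 \<and> x powr (1 - \<gamma>) \<le> x / 2 \<and>
     (\<forall>h. \<bar>h\<bar> \<le> x powr (1 - \<gamma>) \<longrightarrow>
      \<bar>plog a b (x + h) - plog a b x - plog1 a b x * h - plog2 a b x / 2 * h\<^sup>2\<bar>
        \<le> K * x powr (a - 2 - \<gamma> / 2) * h\<^sup>2) \<and>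
     (\<forall>h. \<bar>h\<bar> > x powr (1 - \<gamma>) \<longrightarrow>
      plog a b x + \<bar>plog1 a b x * h\<bar> + \<bar>plog2 a b x / 2 * h\<^sup>2\<bar>
        \<le> 3 * x powr (a - p + (p + 1) * \<gamma>) * \<bar>h\<bar> powr p) \<and>
     (\<forall>\<mu> \<sigma>. \<bar>\<mu> - c / x\<bar> \<le> \<bar>h1 x\<bar> \<longrightarrow> \<bar>\<sigma> - s2\<bar> \<le> \<bar>h2 x\<bar> \<longrightarrow>
     \<bar>plog1 a b x * \<mu> + plog2 a b x / 2 * \<sigma> - (plog1 a b x * (c / x) + plog2 a b x / 2 * s2)\<bar>
       + K * x powr (a - 2 - \<gamma> / 2) * \<bar>\<sigma>\<bar>
       + 3 * x powr (a - p + \<delta> / 2) * (C * (1 + x) powr (p - 2 - \<delta>))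
     \<le> \<kappa> * plog (a - 2) (b - 1) x) \<and>
     \<beta> / 2 * plog (a - 2) (b - 1) x \<le> \<beta> * plog (a - 2) (b - 1) x + b * (b - 1) * plog (a - 2) (b - 2) x \<and>
     1 \<le> plog (a - 2) (b - 1) x" for x
  have "eventually P at_top"
    unfolding P_def
  proof (intro eventually_conj)
    show "eventually (\<lambda>x. x powr (1 - \<gamma>) \<le> x / 2) at_top" using g by real_asymp
    show "eventually (\<lambda>x. \<beta> / 2 * plog (a - 2) (b - 1) x \<le> \<beta> * plog (a - 2) (b - 1) x + b * (b - 1) * plog (a - 2) (b - 2) x) at_top"
      unfolding plog_def using \<beta> by real_asymp
    show "eventually (\<lambda>x. 1 \<le> plog (a - 2) (b - 1) x) at_top"
    proof (cases "a > 2")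
      case True
      then show ?thesis unfolding plog_def by real_asymp
    next
      case False
      then have "a = 2" "b = 1" using assms by auto
      then show ?thesis
        unfolding plog_def by (intro eventually_mono[OF eventually_gt_at_top[of "1::real"]]) auto
    qed
    show "eventually (\<lambda>x. \<forall>h. \<bar>h\<bar> \<le> x powr (1 - \<gamma>) \<longrightarrow>
      \<bar>plog a b (x + h) - plog a b x - plog1 a b x * h - plog2 a b x / 2 * h\<^sup>2\<bar>
        \<le> K * x powr (a - 2 - \<gamma> / 2) * h\<^sup>2) at_top"
      unfolding K_def by (rule plog_Taylor_small[OF g(1)])
  qed (rule plog_large drift_estimate eventually_gt_at_top eventually_ge_at_top
        h g(1) g2 K \<kappa> assms zero_le_numeral)+
  then obtain A where A: "\<And>x. x \<ge> A \<Longrightarrow> P x"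
    by (auto simp: eventually_at_top_linorder)
  note AP = A[unfolded P_def]
  define u where "u = plog1 a b"
  define v where "v x = plog2 a b x / 2 - K * x powr (a - 2 - \<gamma> / 2)" for x
  define w where "w x = 3 * x powr (a - p + \<delta> / 2)" for x
  show ?thesis
  proof (rule that[of A \<kappa> u v w])
    show "u \<in> borel_measurable borel" "v \<in> borel_measurable borel" "w \<in> borel_measurable borel"
      unfolding u_def v_def w_def by measurable
    show "w x \<ge> 0" for x by (simp add: w_def)
    show "A \<ge> A0" "A > 1" using AP[of A] by auto
    show "\<kappa> > 0" by fact
  next
    fix x h R assume x: "A \<le> x" and R: "x < R"
    note Px = AP[OF x]
    have A1: "A > 2" using AP[of A] by auto
    have hK: "0 \<le> K * x powr (a - 2 - \<gamma> / 2) * h\<^sup>2" using K by simp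
    have tx: "trunc_plog a b A R x = plog a b x - plog a b A"
      using x R A1 by (simp add: trunc_plog_def)
    show "u x * h + v x * h\<^sup>2 - w x * \<bar>h\<bar> powr p \<le> trunc_plog a b A R (x + h) - trunc_plog a b A R x"
    proof (cases "\<bar>h\<bar> \<le> x powr (1 - \<gamma>)")
      case True
      have hx: "\<bar>h\<bar> \<le> x / 2" using True Px by linarith
      have "plog a b (x + h) - plog a b A \<le> trunc_plog a b A R (x + h)"
      proof (cases "x + h < A")
        case True
        then have "plog a b (x + h) \<le> plog a b A"
          using hx Px assms by (intro plog_mono) auto
        then show ?thesis using True by (simp add: trunc_plog_def)
      next
        case False
        moreover have "x + h \<le> 2 * R" using hx R x A1 by linarith
        ultimately show ?thesis by (simp add: trunc_plog_def min_def)
      qed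
      moreover have "\<bar>plog a b (x + h) - plog a b x - plog1 a b x * h - plog2 a b x / 2 * h\<^sup>2\<bar>
        \<le> K * x powr (a - 2 - \<gamma> / 2) * h\<^sup>2" using Px True by blast
      moreover have "0 \<le> w x * \<bar>h\<bar> powr p" by (simp add: w_def)
      ultimately show ?thesis
        unfolding u_def v_def tx left_diff_distrib by linarith
    next
      case False
      then have "plog a b x + \<bar>plog1 a b x * h\<bar> + \<bar>plog2 a b x / 2 * h\<^sup>2\<bar> \<le> w x * \<bar>h\<bar> powr p"
        using Px unfolding w_def g(2) by force
      moreover have "0 \<le> trunc_plog a b A R (x + h)"
        using assms A1 x R by (intro trunc_plog_bounds) auto
      moreover have "0 \<le> plog a b A" by (rule plog_nonneg)
      ultimately show ?thesis
        using hK unfolding u_def v_def tx left_diff_distrib by linarith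
    qed
  next
    fix x \<mu> \<sigma> assume x: "A \<le> x" and *: "\<bar>\<mu> - c / x\<bar> \<le> \<bar>h1 x\<bar>" "\<bar>\<sigma> - s2\<bar> \<le> \<bar>h2 x\<bar>"
    note Px = AP[OF x]
    define m where "m = plog1 a b x * (c / x) + plog2 a b x / 2 * s2"
    define q where "q = plog (a - 2) (b - 1) x"
    have 1: "\<bar>plog1 a b x * \<mu> + plog2 a b x / 2 * \<sigma> - m\<bar>
       + K * x powr (a - 2 - \<gamma> / 2) * \<bar>\<sigma>\<bar> + w x * (C * (1 + x) powr (p - 2 - \<delta>)) \<le> \<kappa> * q"
      using Px * unfolding w_def m_def q_def by blast
    have "m = s2 / 2 * (a * (a - 1 + 2 * c / s2) * plog (a - 2) b x + \<beta> * plog (a - 2) (b - 1) x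
               + b * (b - 1) * plog (a - 2) (b - 2) x)"
      unfolding m_def \<beta>_def using assms Px by (intro drift_main_term) auto
    also have "\<dots> \<ge> s2 / 2 * (0 + \<beta> / 2 * q)"
    proof (intro mult_left_mono)
      have "0 \<le> a * (a - 1 + 2 * c / s2) * plog (a - 2) b x"
        using assms plog_nonneg by (intro mult_nonneg_nonneg) auto
      then show "0 + \<beta> / 2 * q \<le> a * (a - 1 + 2 * c / s2) * plog (a - 2) b x + \<beta> * plog (a - 2) (b - 1) x
               + b * (b - 1) * plog (a - 2) (b - 2) x"
        using Px unfolding q_def by linarith
    qed (use assms in auto)
    finally have 2: "m \<ge> 2 * (\<kappa> * q)" by (simp add: \<kappa>_def mult_ac)
    have "\<kappa> * 1 \<le> \<kappa> * q" using Px \<kappa> unfolding q_def by (intro mult_left_mono) auto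
    moreover have "K * x powr (a - 2 - \<gamma> / 2) * \<sigma> \<le> K * x powr (a - 2 - \<gamma> / 2) * \<bar>\<sigma>\<bar>"
      using K by (intro mult_left_mono) auto
    ultimately show "\<kappa> \<le> u x * \<mu> + v x * \<sigma> - w x * (C * (1 + x) powr (p - 2 - \<delta>))"
      using 1 2 unfolding u_def v_def left_diff_distrib by linarith
  qed
qed

definition cut_plog :: "real \<Rightarrow> real \<Rightarrow> real \<Rightarrow> real \<Rightarrow> real" where
  "cut_plog a b A y = (if y < A then 0 else plog a b y)"

lemma measurable_cut_plog [measurable]: "cut_plog a b A \<in> borel_measurable borel"
  unfolding cut_plog_def by measurable

lemma cut_plog_nonneg: "0 \<le> cut_plog a b A y"
  by (simp add: cut_plog_def plog_nonneg)

lemma cut_plog_le_powr: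
  assumes "A \<ge> exp 1"
  shows "cut_plog a (- 1) A y \<le> \<bar>y\<bar> powr a"
proof (cases "y < A")
  case False
  have y: "y \<ge> exp 1" using False assms by linarith
  then have "y > 0" using exp_gt_zero[of "1::real"] by linarith
  with y have "ln y \<ge> 1" by (simp add: ln_ge_iff)
  then have "ln y powr (- 1) \<le> 1 powr (- 1)" by (intro powr_mono2') auto
  then have "y powr a * ln y powr (- 1) \<le> y powr a * 1" by (intro mult_left_mono) auto
  then show ?thesis using False \<open>y > 0\<close> by (simp add: cut_plog_def plog_def)
qed (simp add: cut_plog_def)

lemma upper_test_function:
  assumes h: "h1 \<in> o[at_top](\<lambda>x::real. 1 / (x * ln x))" "h2 \<in> o[at_top](\<lambda>x::real. 1 / ln x)"
    and "\<delta> > 0" "C \<ge> 0" "s2 > 0" "p > 2" "2 \<le> a" "a \<le> p" "a = 2 \<or> a = 1 - 2 * c / s2"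
  obtains A1 A u v w where "A \<ge> A0" "A1 \<ge> exp 1" "A1 \<le> A"
    "\<And>x y. A1 \<le> x \<Longrightarrow> x \<le> y \<Longrightarrow> plog a (- 1) x \<le> plog a (- 1) y"
    "u \<in> borel_measurable borel" "v \<in> borel_measurable borel" "w \<in> borel_measurable borel"
    "\<And>x. w x \<ge> (0::real)"
    "\<And>x h. A \<le> x \<Longrightarrow> cut_plog a (- 1) A1 (x + h) - cut_plog a (- 1) A1 x
        \<le> u x * h + v x * h\<^sup>2 + w x * \<bar>h\<bar> powr p"
    "\<And>x \<mu> \<sigma>. A \<le> x \<Longrightarrow> \<bar>\<mu> - c / x\<bar> \<le> \<bar>h1 x\<bar> \<Longrightarrow> \<bar>\<sigma> - s2\<bar> \<le> \<bar>h2 x\<bar> \<Longrightarrow>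
        u x * \<mu> + v x * \<sigma> + w x * (C * (1 + x) powr (p - 2 - \<delta>)) \<le> 1"
proof -
  define b :: real where "b = - 1"
  define \<gamma> where "\<gamma> = \<delta> / (2 * (p + 1))"
  have g: "\<gamma> > 0" "(p + 1) * \<gamma> = \<delta> / 2" using assms by (auto simp: \<gamma>_def field_simps)
  then have g2: "\<gamma> / 2 > 0" by simp
  define K where "K = 2 powr \<bar>a - 3 + \<gamma> / 2\<bar>"
  have K: "K \<ge> 0" by (simp add: K_def)
  define W where "W = 3 + 2 * 2 powr a"
  have W: "W \<ge> 0" by (simp add: W_def)
  define \<theta> where "\<theta> = s2 * a / 4"
  have \<theta>: "\<theta> > 0" using assms by (simp add: \<theta>_def)
  obtain A1 where A1e: "A1 \<ge> exp 1"
    and mono: "\<And>x y. A1 \<le> x \<Longrightarrow> x \<le> y \<Longrightarrow> plog a b x \<le> plog a b y"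
    using plog_mono_eventually[of a "exp 1" b] assms by auto
  have A1g: "A1 > 1" using A1e one_less_exp_iff[of "1::real"] by linarith
  define P where "P x \<longleftrightarrow> x \<ge> A0 \<and> x \<ge> 2 * A1 \<and> x powr (1 - \<gamma>) \<le> x / 2 \<and>
     (\<forall>h. \<bar>h\<bar> \<le> x powr (1 - \<gamma>) \<longrightarrow>
      \<bar>plog a b (x + h) - plog a b x - plog1 a b x * h - plog2 a b x / 2 * h\<^sup>2\<bar>
        \<le> K * x powr (a - 2 - \<gamma> / 2) * h\<^sup>2) \<and>
     (\<forall>h. \<bar>h\<bar> > x powr (1 - \<gamma>) \<longrightarrow>
      plog a b x + \<bar>plog1 a b x * h\<bar> + \<bar>plog2 a b x / 2 * h\<^sup>2\<bar>
        \<le> 3 * x powr (a - p + (p + 1) * \<gamma>) * \<bar>h\<bar> powr p) \<and>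
     (\<forall>\<mu> \<sigma>. \<bar>\<mu> - c / x\<bar> \<le> \<bar>h1 x\<bar> \<longrightarrow> \<bar>\<sigma> - s2\<bar> \<le> \<bar>h2 x\<bar> \<longrightarrow>
     \<bar>plog1 a b x * \<mu> + plog2 a b x / 2 * \<sigma> - (plog1 a b x * (c / x) + plog2 a b x / 2 * s2)\<bar>
       + K * x powr (a - 2 - \<gamma> / 2) * \<bar>\<sigma>\<bar>
       + W * x powr (a - p + \<delta> / 2) * (C * (1 + x) powr (p - 2 - \<delta>))
     \<le> \<theta> * plog (a - 2) (b - 1) x) \<and>
     s2 / 2 * (a * (a - 1 + 2 * c / s2) * plog (a - 2) b x + b * (2 * a - 1 + 2 * c / s2) * plog (a - 2) (b - 1) x
               + b * (b - 1) * plog (a - 2) (b - 2) x) + \<theta> * plog (a - 2) (b - 1) x \<le> 1" for x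
  have "eventually P at_top"
    unfolding P_def
  proof (intro eventually_conj)
    show "eventually (\<lambda>x. x powr (1 - \<gamma>) \<le> x / 2) at_top" using g by real_asymp
    show "eventually (\<lambda>x. s2 / 2 * (a * (a - 1 + 2 * c / s2) * plog (a - 2) b x + b * (2 * a - 1 + 2 * c / s2) * plog (a - 2) (b - 1) x
               + b * (b - 1) * plog (a - 2) (b - 2) x) + \<theta> * plog (a - 2) (b - 1) x \<le> 1) at_top"
    proof (cases "a = 2")
      case True
      define k where "k = 1 + 2 * c / s2"
      have k: "a - 1 + 2 * c / s2 = k" "2 * a - 1 + 2 * c / s2 = k + 2" by (auto simp: k_def True)
      have "((\<lambda>x. s2 / 2 * (2 * k * (x powr 0 * ln x powr - 1) - (k + 2) * (x powr 0 * ln x powr - 2)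
          + 2 * (x powr 0 * ln x powr - 3)) + \<theta> * (x powr 0 * ln x powr - 2)) \<longlongrightarrow> 0) at_top"
        by real_asymp
      from order_tendstoD(2)[OF this zero_less_one] show ?thesis
        unfolding k by (rule eventually_mono) (simp add: True b_def plog_def algebra_simps)
    next
      case False
      then have a: "a = 1 - 2 * c / s2" using assms by auto
      have a': "a - 1 + 2 * c / s2 = 0" "2 * a - 1 + 2 * c / s2 = a" using a by auto
      have "eventually (\<lambda>x. 2 * s2 * (1/2) * (x powr (a - 2) * ln x powr - 3) \<le> s2 * a / 4 * (x powr (a - 2) * ln x powr - 2)) at_top"
        using assms by real_asymp
      then show ?thesis
      proof (rule eventually_mono)
        fix x assume *: "2 * s2 * (1/2) * (x powr (a - 2) * ln x powr - 3) \<le> s2 * a / 4 * (x powr (a - 2) * ln x powr - 2)"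
        show "s2 / 2 * (a * (a - 1 + 2 * c / s2) * plog (a - 2) b x + b * (2 * a - 1 + 2 * c / s2) * plog (a - 2) (b - 1) x
               + b * (b - 1) * plog (a - 2) (b - 2) x) + \<theta> * plog (a - 2) (b - 1) x \<le> 1"
          unfolding a' using * by (simp add: b_def \<theta>_def plog_def algebra_simps)
      qed
    qed
    show "eventually (\<lambda>x. \<forall>h. \<bar>h\<bar> \<le> x powr (1 - \<gamma>) \<longrightarrow>
      \<bar>plog a b (x + h) - plog a b x - plog1 a b x * h - plog2 a b x / 2 * h\<^sup>2\<bar>
        \<le> K * x powr (a - 2 - \<gamma> / 2) * h\<^sup>2) at_top"
      unfolding K_def by (rule plog_Taylor_small[OF g(1)])
  qed (rule plog_large drift_estimate eventually_gt_at_top eventually_ge_at_top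
        h g(1) g2 K W \<theta> assms)+
  then obtain A where A: "\<And>x. x \<ge> A \<Longrightarrow> P x"
    by (auto simp: eventually_at_top_linorder)
  note AP = A[unfolded P_def]
  define u where "u = plog1 a b"
  define v where "v x = plog2 a b x / 2 + K * x powr (a - 2 - \<gamma> / 2)" for x
  define w where "w x = W * x powr (a - p + \<delta> / 2)" for x
  show ?thesis
  proof (rule that[of A A1 u v w])
    show "u \<in> borel_measurable borel" "v \<in> borel_measurable borel" "w \<in> borel_measurable borel"
      unfolding u_def v_def w_def by measurable
    show "w x \<ge> 0" for x using W by (simp add: w_def)
    show "A \<ge> A0" "A1 \<le> A" using AP[of A] A1g by auto
    show "A1 \<ge> exp 1" by fact
    show "\<And>x y. A1 \<le> x \<Longrightarrow> x \<le> y \<Longrightarrow> plog a (- 1) x \<le> plog a (- 1) y"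
      using mono by (simp add: b_def)
  next
    fix x h assume x: "A \<le> x"
    note Px = AP[OF x]
    have x1: "x > 1" "x \<ge> A1" using Px A1g by auto
    have hK: "0 \<le> K * x powr (a - 2 - \<gamma> / 2) * h\<^sup>2" using K by simp
    have tx: "cut_plog a b A1 x = plog a b x"
      using x1 by (simp add: cut_plog_def)
    have "cut_plog a b A1 (x + h) - cut_plog a b A1 x \<le> u x * h + v x * h\<^sup>2 + w x * \<bar>h\<bar> powr p"
    proof (cases "\<bar>h\<bar> \<le> x powr (1 - \<gamma>)")
      case True
      have hx: "\<bar>h\<bar> \<le> x / 2" using True Px by linarith
      have "cut_plog a b A1 (x + h) = plog a b (x + h)"
      proof -
        have "\<not> x + h < A1" using hx Px by linarith
        then show ?thesis by (simp add: cut_plog_def)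
      qed
      moreover have "\<bar>plog a b (x + h) - plog a b x - plog1 a b x * h - plog2 a b x / 2 * h\<^sup>2\<bar>
        \<le> K * x powr (a - 2 - \<gamma> / 2) * h\<^sup>2" using Px True by blast
      moreover have "0 \<le> w x * \<bar>h\<bar> powr p" using W by (simp add: w_def)
      ultimately show ?thesis
        unfolding u_def v_def tx distrib_right by linarith
    next
      case False
      then have h: "x powr (1 - \<gamma>) < \<bar>h\<bar>" by simp
      then have "plog a b x + \<bar>plog1 a b x * h\<bar> + \<bar>plog2 a b x / 2 * h\<^sup>2\<bar> \<le> 3 * x powr (a - p + \<delta> / 2) * \<bar>h\<bar> powr p"
        using Px unfolding g(2) by blast
      moreover have "cut_plog a b A1 (x + h) \<le> 2 * 2 powr a * x powr (a - p + \<delta> / 2) * \<bar>h\<bar> powr p"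
      proof -
        have "0 < x powr (1 - \<gamma>)" using x1 by simp
        then have h0: "\<bar>h\<bar> > 0" using h by linarith
        have "cut_plog a b A1 (x + h) \<le> \<bar>x + h\<bar> powr a"
          unfolding b_def using A1e by (intro cut_plog_le_powr)
        also have "\<dots> \<le> (x + \<bar>h\<bar>) powr a"
          using assms x1 by (intro powr_mono2) auto
        also have "\<dots> \<le> 2 powr a * (x powr a + \<bar>h\<bar> powr a)"
          using assms x1 by (intro powr_add_le) auto
        also have "\<dots> \<le> 2 powr a * (x powr (a - p + (p + 1) * \<gamma>) * \<bar>h\<bar> powr p + x powr (a - p + (p + 1) * \<gamma>) * \<bar>h\<bar> powr p)"
        proof (intro mult_left_mono add_mono)
          have "x powr a \<le> x powr (a - 0 + \<gamma> / 2)" using x1 g by (intro powr_mono) auto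
          then have "\<bar>x powr a\<bar> * \<bar>h\<bar> powr 0 \<le> x powr (a - p + (p + 1) * \<gamma>) * \<bar>h\<bar> powr p"
            using h x1 g assms by (intro weighted_abs_powr_le_moment) auto
          then show "x powr a \<le> x powr (a - p + (p + 1) * \<gamma>) * \<bar>h\<bar> powr p" using h0 by simp
          have "1 \<le> x powr (a - a + \<gamma> / 2)" using x1 g by (auto intro!: ge_one_powr_ge_zero)
          then have "\<bar>1\<bar> * \<bar>h\<bar> powr a \<le> x powr (a - p + (p + 1) * \<gamma>) * \<bar>h\<bar> powr p"
            using h x1 g assms by (intro weighted_abs_powr_le_moment) auto
          then show "\<bar>h\<bar> powr a \<le> x powr (a - p + (p + 1) * \<gamma>) * \<bar>h\<bar> powr p" by simp
        qed auto
        finally show ?thesis unfolding g(2) by (simp add: mult_ac)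
      qed
      moreover have "0 \<le> plog a b x" by (rule plog_nonneg)
      ultimately show ?thesis
        using hK unfolding u_def v_def w_def W_def tx distrib_right by linarith
    qed
    then show "cut_plog a (- 1) A1 (x + h) - cut_plog a (- 1) A1 x \<le> u x * h + v x * h\<^sup>2 + w x * \<bar>h\<bar> powr p"
      by (simp add: b_def)
  next
    fix x \<mu> \<sigma> assume x: "A \<le> x" and *: "\<bar>\<mu> - c / x\<bar> \<le> \<bar>h1 x\<bar>" "\<bar>\<sigma> - s2\<bar> \<le> \<bar>h2 x\<bar>"
    note Px = AP[OF x]
    define m where "m = plog1 a b x * (c / x) + plog2 a b x / 2 * s2"
    have 1: "\<bar>plog1 a b x * \<mu> + plog2 a b x / 2 * \<sigma> - m\<bar>
       + K * x powr (a - 2 - \<gamma> / 2) * \<bar>\<sigma>\<bar> + w x * (C * (1 + x) powr (p - 2 - \<delta>)) \<le> \<theta> * plog (a - 2) (b - 1) x"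
      using Px * unfolding w_def m_def by blast
    have "m = s2 / 2 * (a * (a - 1 + 2 * c / s2) * plog (a - 2) b x + b * (2 * a - 1 + 2 * c / s2) * plog (a - 2) (b - 1) x
               + b * (b - 1) * plog (a - 2) (b - 2) x)"
      unfolding m_def using assms Px A1g by (intro drift_main_term) auto
    then have "m + \<theta> * plog (a - 2) (b - 1) x \<le> 1" using Px by (simp only:)
    moreover have "K * x powr (a - 2 - \<gamma> / 2) * \<sigma> \<le> K * x powr (a - 2 - \<gamma> / 2) * \<bar>\<sigma>\<bar>"
      using K by (intro mult_left_mono) auto
    ultimately show "u x * \<mu> + v x * \<sigma> + w x * (C * (1 + x) powr (p - 2 - \<delta>)) \<le> 1"
      using 1 unfolding u_def v_def distrib_right by linarith
  qed
qed

section \<open>Telescoping and dyadic arguments for real sequences\<close>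

lemma telescope_stopped:
  fixes x :: "nat \<Rightarrow> real" and f :: "real \<Rightarrow> real"
  shows "\<exists>j\<ge>1. (\<Sum>t=1..n. if \<forall>s\<in>{1..t}. x s < R then f (x (t + 1)) - f (x t) else 0) = f (x j) - f (x 1) \<and>
    (if \<forall>s\<in>{1..Suc n}. x s < R then j = Suc n else x j \<ge> R)"
proof (induction n)
  case 0
  show ?case by (intro exI[of _ 1]) auto
next
  case (Suc n)
  then obtain j where j: "j \<ge> 1"
    "(\<Sum>t=1..n. if \<forall>s\<in>{1..t}. x s < R then f (x (t + 1)) - f (x t) else 0) = f (x j) - f (x 1)"
    "if \<forall>s\<in>{1..Suc n}. x s < R then j = Suc n else x j \<ge> R" by blast
  show ?case
  proof (cases "\<forall>s\<in>{1..Suc n}. x s < R")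
    case True
    then have jn: "j = Suc n" using j(3) by (simp only: if_True)
    have "(\<forall>s\<in>{1..Suc (Suc n)}. x s < R) \<longleftrightarrow> x (Suc (Suc n)) < R"
      using True by (auto simp: atLeastAtMostSuc_conv)
    then show ?thesis using j(2) True jn
      by (intro exI[of _ "Suc (Suc n)"]) (simp add: not_less)
  next
    case False
    then have F: "\<not> (\<forall>s\<in>{1..Suc (Suc n)}. x s < R)"
      by (meson atLeastAtMost_iff le_Suc_eq)
    have "x j \<ge> R" using j(3) False by (simp only: if_False)
    moreover have "(\<Sum>t=1..Suc n. if \<forall>s\<in>{1..t}. x s < R then f (x (t + 1)) - f (x t) else 0) = f (x j) - f (x 1)"
      using j(2) False by (subst sum.nat_ivl_Suc', simp) (simp only: if_False add_0_left add_0_right)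
    ultimately show ?thesis using j(1) F by (intro exI[of _ j]) (simp only: if_False)
  qed
qed

lemma sum_shift_diff_le:
  fixes b :: "nat \<Rightarrow> real"
  assumes "\<And>t. 0 \<le> b t" "\<And>t. b t \<le> 1"
  shows "(\<Sum>t=1..n. b t - b (t + j)) \<le> j"
proof (induction j)
  case (Suc j)
  have "(\<Sum>t=1..n. b t - b (t + Suc j)) = (\<Sum>t=1..n. b t - b (t + j)) + (\<Sum>t=1..n. b (t + j) - b (t + Suc j))"
    by (simp add: sum.distrib[symmetric])
  also have "(\<Sum>t=1..n. b (t + j) - b (t + Suc j)) = b (Suc j) - b (Suc n + j)"
    by (induction n) auto
  also have "\<dots> \<le> 1" using assms(1)[of "Suc n + j"] assms(2)[of "Suc j"] by simp
  finally show ?case using Suc by simp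
qed simp

lemma dyadic_index:
  assumes "t \<ge> (2::nat) ^ J"
  obtains j where "j \<ge> J" "2 ^ j \<le> t" "t < 2 ^ (j + 1)"
proof -
  have "1 \<le> t" using assms one_le_power[of "2::nat" J] by linarith
  then obtain j where j: "2 ^ j \<le> t" "t < 2 ^ (j + 1)"
    using ex_power_ivl1[of 2 t] by auto
  have "(2::nat) ^ J < 2 ^ (j + 1)" using assms j by linarith
  then have "J < j + 1" by (simp only: power_strict_increasing_iff one_less_numeral_iff semiring_norm)
  then show ?thesis using j by (intro that[of j]) auto
qed

lemma dyadic_max_le:
  fixes x :: "nat \<Rightarrow> real" and U :: "real \<Rightarrow> real"
  assumes mono: "\<And>y z. Y \<le> y \<Longrightarrow> y \<le> z \<Longrightarrow> U y \<le> U z"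
    and ev: "eventually (\<lambda>j. \<forall>s\<in>{1..2 ^ (j + 1)}. x s < U (2 ^ j)) sequentially"
  shows "eventually (\<lambda>t. (MAX s\<in>{1..t}. x s) \<le> U (real t)) sequentially"
proof -
  have "filterlim (\<lambda>j. 2 ^ j :: real) at_top sequentially" by real_asymp
  then have "eventually (\<lambda>j. Y \<le> 2 ^ j) sequentially" by (simp add: filterlim_at_top)
  with ev have "eventually (\<lambda>j. Y \<le> 2 ^ j \<and> (\<forall>s\<in>{1..2 ^ (j + 1)}. x s < U (2 ^ j))) sequentially"
    by eventually_elim simp
  then obtain J where J: "\<And>j. j \<ge> J \<Longrightarrow> Y \<le> 2 ^ j \<and> (\<forall>s\<in>{1..2 ^ (j + 1)}. x s < U (2 ^ j))"
    by (auto simp: eventually_sequentially)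
  show ?thesis
    unfolding eventually_sequentially
  proof (intro exI[of _ "2 ^ J"] allI impI)
    fix t :: nat assume t: "2 ^ J \<le> t"
    then obtain j where j: "j \<ge> J" "2 ^ j \<le> t" "t < 2 ^ (j + 1)" by (rule dyadic_index)
    have "t \<ge> 1" using t one_le_power[of "2::nat" J] by linarith
    have "(2::real) ^ j \<le> real t" using j(2) by (metis of_nat_le_iff of_nat_numeral of_nat_power)
    then have U: "U (2 ^ j) \<le> U (real t)" using J[OF j(1)] by (intro mono) auto
    show "(MAX s\<in>{1..t}. x s) \<le> U (real t)"
    proof (rule Max.boundedI)
      fix z assume "z \<in> x ` {1..t}"
      then obtain s where "s \<in> {1..t}" "z = x s" by blast
      moreover have "s \<in> {1..2 ^ (j + 1)}" using \<open>s \<in> {1..t}\<close> j by auto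
      ultimately show "z \<le> U (real t)" using J[OF j(1)] U by fastforce
    qed (use \<open>t \<ge> 1\<close> in auto)
  qed
qed

lemma dyadic_max_ge:
  fixes x :: "nat \<Rightarrow> real" and L :: "real \<Rightarrow> real"
  assumes mono: "\<And>y z. Y \<le> y \<Longrightarrow> y \<le> z \<Longrightarrow> L y \<le> L z"
    and ev: "eventually (\<lambda>j. \<exists>s\<in>{1..2 ^ j}. L (2 ^ (j + 1)) \<le> x s) sequentially"
  shows "eventually (\<lambda>t. L (real t) \<le> (MAX s\<in>{1..t}. x s)) sequentially"
proof -
  have "filterlim (\<lambda>j. 2 ^ j :: real) at_top sequentially" by real_asymp
  then have "eventually (\<lambda>j. Y \<le> 2 ^ j) sequentially" by (simp add: filterlim_at_top)
  with ev have "eventually (\<lambda>j. Y \<le> 2 ^ j \<and> (\<exists>s\<in>{1..2 ^ j}. L (2 ^ (j + 1)) \<le> x s)) sequentially"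
    by eventually_elim simp
  then obtain J where J: "\<And>j. j \<ge> J \<Longrightarrow> Y \<le> 2 ^ j \<and> (\<exists>s\<in>{1..2 ^ j}. L (2 ^ (j + 1)) \<le> x s)"
    by (auto simp: eventually_sequentially)
  show ?thesis
    unfolding eventually_sequentially
  proof (intro exI[of _ "2 ^ J"] allI impI)
    fix t :: nat assume t: "2 ^ J \<le> t"
    then obtain j where j: "j \<ge> J" "2 ^ j \<le> t" "t < 2 ^ (j + 1)" by (rule dyadic_index)
    have 1: "(2::real) ^ j \<le> real t" using j(2) by (metis of_nat_le_iff of_nat_numeral of_nat_power)
    have 2: "real t \<le> 2 ^ (j + 1)" using j(3) by (metis less_imp_le of_nat_le_iff of_nat_numeral of_nat_power)
    obtain s where s: "s \<in> {1..2 ^ j}" "L (2 ^ (j + 1)) \<le> x s" using J[OF j(1)] by blast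
    have "L (real t) \<le> L (2 ^ (j + 1))" using J[OF j(1)] 1 2 by (intro mono) linarith+
    also have "\<dots> \<le> x s" by fact
    also have "\<dots> \<le> (MAX s\<in>{1..t}. x s)" using s j by (intro Max_ge) auto
    finally show "L (real t) \<le> (MAX s\<in>{1..t}. x s)" .
  qed
qed

lemma summable_ln_powr_dyadic:
  assumes "f \<in> O(\<lambda>x::real. ln x powr e)" "e < -1"
  shows "summable (\<lambda>j::nat. f (2 ^ (j + k)))"
proof -
  have "filterlim (\<lambda>j::nat. 2 ^ j :: real) at_top sequentially" by real_asymp
  from landau_o.big.compose[OF assms(1) this]
  have "(\<lambda>j::nat. f (2 ^ j)) \<in> O(\<lambda>j. ln (2 ^ j) powr e)" .
  also have "(\<lambda>j::nat. ln (2 ^ j :: real) powr e) \<in> O(\<lambda>j. real j powr e)"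
    by real_asymp
  finally have 1: "(\<lambda>j::nat. f (2 ^ j)) \<in> O(\<lambda>j. real j powr e)" .
  have "summable (\<lambda>j. norm (real j powr e))" using assms(2) by (simp add: summable_real_powr_iff)
  from summable_comparison_test_bigo[OF this 1] have "summable (\<lambda>j::nat. f (2 ^ j))" .
  then show ?thesis by (subst summable_iff_shift)
qed

lemma (in prob_space) AE_eventually_in:
  assumes [measurable]: "\<And>j::nat. G j \<in> sets M"
    and le: "eventually (\<lambda>j. prob (space M - G j) \<le> b j) sequentially" and "summable b"
  shows "AE \<omega> in M. eventually (\<lambda>j. \<omega> \<in> G j) sequentially"
proof -
  have "AE \<omega> in M. eventually (\<lambda>j. \<omega> \<in> space M - (space M - G j)) sequentially"
  proof (rule borel_cantelli_AE1)
    show "summable (\<lambda>j. prob (space M - G j))"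
      using le by (intro summable_comparison_test_ev[OF _ \<open>summable b\<close>]) simp
    show "emeasure M (space M - G j) < \<infinity>" for j by (simp add: less_top[symmetric])
  qed measurable
  then show ?thesis
  proof eventually_elim
    case (elim \<omega>)
    then show ?case by (rule eventually_mono) blast
  qed
qed

section \<open>Moment and drift estimates along the process\<close>

locale lamperti_process = prob_space M for M :: "'a measure" +
  fixes F :: "nat \<Rightarrow> 'a measure" and X :: "nat \<Rightarrow> 'a \<Rightarrow> real" and S :: "real set"
    and c s2 p \<delta> C x0 :: real and h1 h2 :: "real \<Rightarrow> real"
    and m :: "real \<Rightarrow> real \<Rightarrow> nat" and \<phi> :: "real \<Rightarrow> real \<Rightarrow> real"
  assumes S_nonneg: "S \<subseteq> {0..}"
    and S_locfin: "\<And>b. finite (S \<inter> {..b})" and S_unbdd: "\<not> bdd_above S"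
    and F_sub: "\<And>t. t \<ge> 1 \<Longrightarrow> subalgebra M (F t)"
    and F_mono: "\<And>s t. 1 \<le> s \<Longrightarrow> s \<le> t \<Longrightarrow> sets (F s) \<subseteq> sets (F t)"
    and adapted: "\<And>t. t \<ge> 1 \<Longrightarrow> X t \<in> borel_measurable (F t)"
    and X_in_S: "\<And>t \<omega>. t \<ge> 1 \<Longrightarrow> \<omega> \<in> space M \<Longrightarrow> X t \<omega> \<in> S"
    and X_1: "AE \<omega> in M. X 1 \<omega> = 0"
    and m_ge: "\<And>x y. x \<in> S \<Longrightarrow> y \<in> S \<Longrightarrow> m x y \<ge> 1"
    and \<phi>_pos: "\<And>x y. x \<in> S \<Longrightarrow> y \<in> S \<Longrightarrow> \<phi> x y > 0"
    and irred: "\<And>y t. y \<in> S \<Longrightarrow> t \<ge> 1 \<Longrightarrow> AE \<omega> in M.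
       real_cond_exp M (F t) (\<lambda>\<omega>'. indicator {\<omega>''. X (t + m (X t \<omega>'') y) \<omega>'' = y} \<omega>') \<omega> \<ge> \<phi> (X t \<omega>) y"
    and s2_pos: "s2 > 0"
    and h1: "h1 \<in> o[at_top](\<lambda>x::real. 1 / (x * ln x))" and h2: "h2 \<in> o[at_top](\<lambda>x::real. 1 / ln x)"
    and drift: "\<And>t. t \<ge> 1 \<Longrightarrow> AE \<omega> in M. X t \<omega> \<ge> x0 \<longrightarrow>
       \<bar>real_cond_exp M (F t) (\<lambda>\<omega>'. X (t+1) \<omega>' - X t \<omega>') \<omega> - c / X t \<omega>\<bar> \<le> \<bar>h1 (X t \<omega>)\<bar> \<and>
       \<bar>real_cond_exp M (F t) (\<lambda>\<omega>'. (X (t+1) \<omega>' - X t \<omega>')\<^sup>2) \<omega> - s2\<bar> \<le> \<bar>h2 (X t \<omega>)\<bar>"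
    and p_gt: "p > 2" and \<delta>_pos: "\<delta> > 0" and C_nonneg: "C \<ge> 0"
    and moment: "\<And>t. t \<ge> 1 \<Longrightarrow> AE \<omega> in M.
        nn_cond_exp M (F t) (\<lambda>\<omega>. ennreal (\<bar>X (t+1) \<omega> - X t \<omega>\<bar> powr p)) \<omega>
          \<le> ennreal (C * (1 + X t \<omega>) powr (p - 2 - \<delta>))"
begin

abbreviation \<Delta> :: "nat \<Rightarrow> 'a \<Rightarrow> real" where "\<Delta> t \<omega> \<equiv> X (t + 1) \<omega> - X t \<omega>"

lemma X_measurable [measurable]: "t \<ge> 1 \<Longrightarrow> X t \<in> borel_measurable M"
  using adapted F_sub measurable_from_subalg by blast

lemma X_nonneg: "t \<ge> 1 \<Longrightarrow> \<omega> \<in> space M \<Longrightarrow> 0 \<le> X t \<omega>"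
  using X_in_S S_nonneg by fastforce

lemma sigma_finite_F:
  assumes "t \<ge> 1"
  shows "sigma_finite_subalgebra M (F t)"
proof -
  interpret finite_measure_subalgebra M "F t"
    by unfold_locales (rule F_sub[OF assms])
  show ?thesis by (rule sigma_finite_subalgebra_axioms)
qed

lemma countable_S: "countable S"
proof -
  have "S = (\<Union>n::nat. S \<inter> {..real n})"
    by (auto intro: real_arch_simple)
  moreover have "countable (\<Union>n::nat. S \<inter> {..real n})"
    by (intro countable_UN countableI_type countable_finite S_locfin)
  ultimately show ?thesis by simp
qed

lemma bounded_on_S: "\<exists>B\<ge>0. \<forall>x\<in>S. x < R \<longrightarrow> \<bar>u x\<bar> \<le> (B::real)"
proof -
  have "finite ((\<lambda>x. \<bar>u x\<bar>) ` (S \<inter> {..R}))" using S_locfin by blast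
  then have "bdd_above ((\<lambda>x. \<bar>u x\<bar>) ` (S \<inter> {..R}))" by (rule bdd_above_finite)
  then obtain B where "\<And>x. x \<in> S \<Longrightarrow> x \<le> R \<Longrightarrow> \<bar>u x\<bar> \<le> B" by (auto simp: bdd_above_def)
  then show ?thesis by (intro exI[of _ "max B 0"]) (auto simp: le_max_iff_disj)
qed

lemma F_sets_M: "t \<ge> 1 \<Longrightarrow> G \<in> sets (F t) \<Longrightarrow> G \<in> sets M"
  using F_sub by (auto simp: subalgebra_def)

lemma moment_on:
  assumes t: "t \<ge> 1" and G: "G \<in> sets (F t)" and GR: "\<And>\<omega>. \<omega> \<in> G \<Longrightarrow> X t \<omega> < R"
    and [measurable]: "w \<in> borel_measurable borel" and w: "\<And>x. w x \<ge> 0"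
  shows "integrable M (\<lambda>\<omega>. indicator G \<omega> * w (X t \<omega>) * \<bar>\<Delta> t \<omega>\<bar> powr p)" (is ?A)
    and "integrable M (\<lambda>\<omega>. indicator G \<omega> * w (X t \<omega>) * (C * (1 + X t \<omega>) powr (p - 2 - \<delta>)))" (is ?B)
    and "(\<integral>\<omega>. indicator G \<omega> * w (X t \<omega>) * \<bar>\<Delta> t \<omega>\<bar> powr p \<partial>M)
      \<le> (\<integral>\<omega>. indicator G \<omega> * w (X t \<omega>) * (C * (1 + X t \<omega>) powr (p - 2 - \<delta>)) \<partial>M)" (is ?C)
proof -
  interpret sigma_finite_subalgebra M "F t" using sigma_finite_F[OF t] .
  have [measurable]: "X t \<in> borel_measurable (F t)" "X t \<in> borel_measurable M" "X (t + 1) \<in> borel_measurable M"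
    "G \<in> sets (F t)" "G \<in> sets M" using t adapted G F_sets_M by auto
  obtain B where B: "\<And>x. x \<in> S \<Longrightarrow> x < R \<Longrightarrow> \<bar>w x * (C * (1 + x) powr (p - 2 - \<delta>))\<bar> \<le> B" "B \<ge> 0"
    using bounded_on_S[of R "\<lambda>x. w x * (C * (1 + x) powr (p - 2 - \<delta>))"] by blast
  show 2: ?B
  proof (rule integrable_const_bound[of _ B])
    show "AE \<omega> in M. norm (indicator G \<omega> * w (X t \<omega>) * (C * (1 + X t \<omega>) powr (p - 2 - \<delta>))) \<le> B"
      using B GR X_in_S[OF t] by (auto simp: indicator_def mult.assoc)
  qed measurable
  have nn: "(\<integral>\<^sup>+\<omega>. ennreal (indicator G \<omega> * w (X t \<omega>) * \<bar>\<Delta> t \<omega>\<bar> powr p) \<partial>M)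
      \<le> (\<integral>\<^sup>+\<omega>. ennreal (indicator G \<omega> * w (X t \<omega>) * (C * (1 + X t \<omega>) powr (p - 2 - \<delta>))) \<partial>M)"
  proof -
    have "(\<integral>\<^sup>+\<omega>. ennreal (indicator G \<omega> * w (X t \<omega>) * \<bar>\<Delta> t \<omega>\<bar> powr p) \<partial>M)
      = (\<integral>\<^sup>+\<omega>. ennreal (indicator G \<omega> * w (X t \<omega>)) * ennreal (\<bar>\<Delta> t \<omega>\<bar> powr p) \<partial>M)"
      using w by (simp add: ennreal_mult)
    also have "\<dots> = (\<integral>\<^sup>+\<omega>. ennreal (indicator G \<omega> * w (X t \<omega>)) * nn_cond_exp M (F t) (\<lambda>\<omega>. ennreal (\<bar>\<Delta> t \<omega>\<bar> powr p)) \<omega> \<partial>M)"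
      by (rule nn_cond_exp_intg[symmetric]) measurable
    also have "\<dots> \<le> (\<integral>\<^sup>+\<omega>. ennreal (indicator G \<omega> * w (X t \<omega>)) * ennreal (C * (1 + X t \<omega>) powr (p - 2 - \<delta>)) \<partial>M)"
      using moment[OF t] by (intro nn_integral_mono_AE) (auto elim!: eventually_mono intro: mult_left_mono)
    also have "\<dots> = (\<integral>\<^sup>+\<omega>. ennreal (indicator G \<omega> * w (X t \<omega>) * (C * (1 + X t \<omega>) powr (p - 2 - \<delta>))) \<partial>M)"
      using w C_nonneg by (simp add: ennreal_mult)
    finally show ?thesis .
  qed
  show 1: ?A
  proof (rule integrableI_nonneg)
    have "(\<integral>\<^sup>+\<omega>. ennreal (indicator G \<omega> * w (X t \<omega>) * (C * (1 + X t \<omega>) powr (p - 2 - \<delta>))) \<partial>M) < \<infinity>"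
      using 2 C_nonneg w by (subst nn_integral_eq_integral) auto
    with nn show "(\<integral>\<^sup>+\<omega>. ennreal (indicator G \<omega> * w (X t \<omega>) * \<bar>\<Delta> t \<omega>\<bar> powr p) \<partial>M) < \<infinity>" by order
  qed (use w in auto)
  show ?C
    using nn 1 2 w C_nonneg by (simp add: nn_integral_eq_integral)
qed

lemma increment_integrable:
  assumes t: "t \<ge> 1" and G: "G \<in> sets (F t)" and GR: "\<And>\<omega>. \<omega> \<in> G \<Longrightarrow> X t \<omega> < R"
    and q: "q \<le> p" "0 \<le> q" and [measurable]: "f \<in> borel_measurable M"
    and f: "\<And>\<omega>. \<omega> \<in> G \<Longrightarrow> \<bar>f \<omega>\<bar> \<le> K * (1 + \<bar>\<Delta> t \<omega>\<bar> powr q)" and K: "K \<ge> 0"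
  shows "integrable M (\<lambda>\<omega>. indicator G \<omega> * f \<omega>)"
proof (rule Bochner_Integration.integrable_bound)
  have [measurable]: "G \<in> sets M" using t G F_sets_M by auto
  show "integrable M (\<lambda>\<omega>. K * 2 * 1 + K * (indicator G \<omega> * 1 * \<bar>\<Delta> t \<omega>\<bar> powr p))"
    using moment_on(1)[OF t G GR, of "\<lambda>_. 1"] by (intro Bochner_Integration.integrable_add
        Bochner_Integration.integrable_mult_right) auto
  show "AE \<omega> in M. norm (indicator G \<omega> * f \<omega>) \<le> norm (K * 2 * 1 + K * (indicator G \<omega> * 1 * \<bar>\<Delta> t \<omega>\<bar> powr p))"
  proof (rule AE_I2)
    fix \<omega>
    have "\<bar>\<Delta> t \<omega>\<bar> powr q \<le> 1 + \<bar>\<Delta> t \<omega>\<bar> powr p"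
      using q by (intro powr_le_one_add_powr) auto
    then have "K * (1 + \<bar>\<Delta> t \<omega>\<bar> powr q) \<le> K * (1 + (1 + \<bar>\<Delta> t \<omega>\<bar> powr p))"
      using K by (intro mult_left_mono) auto
    then show "norm (indicator G \<omega> * f \<omega>) \<le> norm (K * 2 * 1 + K * (indicator G \<omega> * 1 * \<bar>\<Delta> t \<omega>\<bar> powr p))"
      using f[of \<omega>] K by (auto simp: indicator_def algebra_simps)
  qed
  show "(\<lambda>\<omega>. indicator G \<omega> * f \<omega>) \<in> borel_measurable M" by measurable
qed

lemma drift_ge:
  assumes t: "t \<ge> 1" and G: "G \<in> sets (F t)" and GR: "\<And>\<omega>. \<omega> \<in> G \<Longrightarrow> A \<le> X t \<omega> \<and> X t \<omega> < R"
    and A: "x0 \<le> A"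
    and Z: "integrable M (\<lambda>\<omega>. indicator G \<omega> * Z \<omega>)"
    and [measurable]: "u \<in> borel_measurable borel" "v \<in> borel_measurable borel" "w \<in> borel_measurable borel"
    and w: "\<And>x. w x \<ge> 0"
    and Z_ge: "\<And>\<omega>. \<omega> \<in> G \<Longrightarrow> u (X t \<omega>) * \<Delta> t \<omega> + v (X t \<omega>) * (\<Delta> t \<omega>)\<^sup>2 - w (X t \<omega>) * \<bar>\<Delta> t \<omega>\<bar> powr p \<le> Z \<omega>"
    and \<kappa>: "\<And>x \<mu> \<sigma>. A \<le> x \<Longrightarrow> \<bar>\<mu> - c / x\<bar> \<le> \<bar>h1 x\<bar> \<Longrightarrow> \<bar>\<sigma> - s2\<bar> \<le> \<bar>h2 x\<bar> \<Longrightarrow>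
        \<kappa> \<le> u x * \<mu> + v x * \<sigma> - w x * (C * (1 + x) powr (p - 2 - \<delta>))"
  shows "\<kappa> * prob G \<le> (\<integral>\<omega>. indicator G \<omega> * Z \<omega> \<partial>M)"
proof -
  interpret sigma_finite_subalgebra M "F t" using sigma_finite_F[OF t] .
  have [measurable]: "X t \<in> borel_measurable (F t)" "X t \<in> borel_measurable M" "X (t + 1) \<in> borel_measurable M"
    "G \<in> sets (F t)" "G \<in> sets M" using t adapted G F_sets_M by auto
  have XS: "X t \<omega> \<in> S" if "\<omega> \<in> G" for \<omega>
    using that X_in_S[OF t] sets.sets_into_space[OF \<open>G \<in> sets M\<close>] by blast
  obtain Bu where Bu: "\<And>x. x \<in> S \<Longrightarrow> x < R \<Longrightarrow> \<bar>u x\<bar> \<le> Bu" "Bu \<ge> 0"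
    using bounded_on_S[of R u] by blast
  obtain Bv where Bv: "\<And>x. x \<in> S \<Longrightarrow> x < R \<Longrightarrow> \<bar>v x\<bar> \<le> Bv" "Bv \<ge> 0"
    using bounded_on_S[of R v] by blast
  have i1: "integrable M (\<lambda>\<omega>. indicator G \<omega> * (u (X t \<omega>) * \<Delta> t \<omega>))"
  proof (rule increment_integrable[OF t G, of R 1 _ Bu])
    fix \<omega> assume "\<omega> \<in> G"
    then have "\<bar>u (X t \<omega>)\<bar> * \<bar>\<Delta> t \<omega>\<bar> \<le> Bu * \<bar>\<Delta> t \<omega>\<bar>" using Bu GR XS by (intro mult_right_mono) auto
    also have "\<dots> \<le> Bu * (1 + \<bar>\<Delta> t \<omega>\<bar> powr 1)" using Bu by (intro mult_left_mono) auto
    finally show "\<bar>u (X t \<omega>) * \<Delta> t \<omega>\<bar> \<le> Bu * (1 + \<bar>\<Delta> t \<omega>\<bar> powr 1)" by (simp add: abs_mult)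
  qed (use GR p_gt Bu in auto)
  have i2: "integrable M (\<lambda>\<omega>. indicator G \<omega> * (v (X t \<omega>) * (\<Delta> t \<omega>)\<^sup>2))"
  proof (rule increment_integrable[OF t G, of R 2 _ Bv])
    fix \<omega> assume "\<omega> \<in> G"
    then have "\<bar>v (X t \<omega>)\<bar> * (\<Delta> t \<omega>)\<^sup>2 \<le> Bv * (\<Delta> t \<omega>)\<^sup>2" using Bv GR XS by (intro mult_right_mono) auto
    also have "\<dots> \<le> Bv * (1 + \<bar>\<Delta> t \<omega>\<bar> powr 2)" using Bv by (intro mult_left_mono) (auto simp: powr_numeral)
    finally show "\<bar>v (X t \<omega>) * (\<Delta> t \<omega>)\<^sup>2\<bar> \<le> Bv * (1 + \<bar>\<Delta> t \<omega>\<bar> powr 2)" by (simp add: abs_mult)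
  qed (use GR p_gt Bv in auto)
  define U where "U \<omega> = indicator G \<omega> * u (X t \<omega>)" for \<omega>
  define V where "V \<omega> = indicator G \<omega> * v (X t \<omega>)" for \<omega>
  have [measurable]: "U \<in> borel_measurable (F t)" "V \<in> borel_measurable (F t)"
    unfolding U_def V_def by measurable
  have iU: "integrable M (\<lambda>\<omega>. U \<omega> * \<Delta> t \<omega>)" and iV: "integrable M (\<lambda>\<omega>. V \<omega> * (\<Delta> t \<omega>)\<^sup>2)"
    using i1 i2 by (simp_all add: U_def V_def mult.assoc)
  define \<mu> where "\<mu> = real_cond_exp M (F t) (\<Delta> t)"
  define \<sigma> where "\<sigma> = real_cond_exp M (F t) (\<lambda>\<omega>. (\<Delta> t \<omega>)\<^sup>2)"
  have U: "integrable M (\<lambda>\<omega>. U \<omega> * \<mu> \<omega>)" "(\<integral>\<omega>. U \<omega> * \<mu> \<omega> \<partial>M) = (\<integral>\<omega>. U \<omega> * \<Delta> t \<omega> \<partial>M)"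
    unfolding \<mu>_def by (rule real_cond_exp_intg[OF iU]; measurable)+
  have V: "integrable M (\<lambda>\<omega>. V \<omega> * \<sigma> \<omega>)" "(\<integral>\<omega>. V \<omega> * \<sigma> \<omega> \<partial>M) = (\<integral>\<omega>. V \<omega> * (\<Delta> t \<omega>)\<^sup>2 \<partial>M)"
    unfolding \<sigma>_def by (rule real_cond_exp_intg[OF iV]; measurable)+
  have GR': "\<And>\<omega>. \<omega> \<in> G \<Longrightarrow> X t \<omega> < R" using GR by blast
  define W where "W \<omega> = indicator G \<omega> * w (X t \<omega>) * \<bar>\<Delta> t \<omega>\<bar> powr p" for \<omega>
  define W' where "W' \<omega> = indicator G \<omega> * w (X t \<omega>) * (C * (1 + X t \<omega>) powr (p - 2 - \<delta>))" for \<omega>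
  have W: "integrable M W" "integrable M W'" "(\<integral>\<omega>. W \<omega> \<partial>M) \<le> (\<integral>\<omega>. W' \<omega> \<partial>M)"
    unfolding W_def W'_def by (rule moment_on[OF t G GR' _ w]; simp)+
  have iG: "integrable M (indicator G :: 'a \<Rightarrow> real)"
    by (auto intro!: integrable_real_indicator simp: less_top[symmetric])
  have "\<kappa> * prob G = (\<integral>\<omega>. \<kappa> * indicator G \<omega> \<partial>M)"
    by simp
  also have "\<dots> \<le> (\<integral>\<omega>. U \<omega> * \<mu> \<omega> + V \<omega> * \<sigma> \<omega> - W' \<omega> \<partial>M)"
  proof (rule integral_mono_AE)
    show "AE \<omega> in M. \<kappa> * indicator G \<omega> \<le> U \<omega> * \<mu> \<omega> + V \<omega> * \<sigma> \<omega> - W' \<omega>"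
      using drift[OF t]
    proof eventually_elim
      case (elim \<omega>)
      show ?case
      proof (cases "\<omega> \<in> G")
        case True
        then have "A \<le> X t \<omega>" "x0 \<le> X t \<omega>" using GR A by force+
        with \<kappa>[of "X t \<omega>" "\<mu> \<omega>" "\<sigma> \<omega>"] elim True show ?thesis
          by (simp add: U_def V_def W'_def \<mu>_def \<sigma>_def)
      qed (simp add: U_def V_def W'_def)
    qed
  qed (use U V W iG in auto)
  also have "\<dots> = (\<integral>\<omega>. U \<omega> * \<Delta> t \<omega> \<partial>M) + (\<integral>\<omega>. V \<omega> * (\<Delta> t \<omega>)\<^sup>2 \<partial>M) - (\<integral>\<omega>. W' \<omega> \<partial>M)"
    using U V W by simp
  also have "\<dots> \<le> (\<integral>\<omega>. U \<omega> * \<Delta> t \<omega> \<partial>M) + (\<integral>\<omega>. V \<omega> * (\<Delta> t \<omega>)\<^sup>2 \<partial>M) - (\<integral>\<omega>. W \<omega> \<partial>M)"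
    using W by simp
  also have "\<dots> = (\<integral>\<omega>. U \<omega> * \<Delta> t \<omega> + V \<omega> * (\<Delta> t \<omega>)\<^sup>2 - W \<omega> \<partial>M)"
    using iU iV W by simp
  also have "\<dots> \<le> (\<integral>\<omega>. indicator G \<omega> * Z \<omega> \<partial>M)"
  proof (rule integral_mono_AE)
    show "AE \<omega> in M. U \<omega> * \<Delta> t \<omega> + V \<omega> * (\<Delta> t \<omega>)\<^sup>2 - W \<omega> \<le> indicator G \<omega> * Z \<omega>"
      using Z_ge by (auto simp: U_def V_def W_def indicator_def)
  qed (use iU iV W Z in auto)
  finally show ?thesis .
qed

definition below :: "real \<Rightarrow> nat \<Rightarrow> 'a set" where
  "below R t = {\<omega> \<in> space M. \<forall>s\<in>{1..t}. X s \<omega> < R}"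

lemma below_F: "t \<ge> 1 \<Longrightarrow> below R t \<in> sets (F t)"
proof -
  assume t: "t \<ge> 1"
  have sp: "space M = space (F t)" using F_sub[OF t] by (simp add: subalgebra_def)
  have "X s \<in> borel_measurable (F t)" if "s \<in> {1..t}" for s
  proof (rule measurable_from_subalg[OF _ adapted])
    have "space (F s) = space (F t)" using F_sub[of s] that sp by (auto simp: subalgebra_def)
    then show "subalgebra (F t) (F s)" using F_mono[of s t] that by (auto simp: subalgebra_def)
  qed (use that in auto)
  then show ?thesis unfolding below_def sp by (intro sets.sets_Collect_finite_All' borel_measurable_less) (use t in auto)
qed

lemma below_M [measurable]: "below R t \<in> sets M"
proof (cases "t \<ge> 1")
  case True then show ?thesis using below_F F_sets_M by blast
next
  case False
  then have "below R t = space M" by (auto simp: below_def)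
  then show ?thesis by simp
qed

lemma below_antimono: "s \<le> t \<Longrightarrow> below R t \<subseteq> below R s"
  by (auto simp: below_def)

lemma one_step_cut_plog:
  assumes a: "2 \<le> a" "a \<le> p" "a = 2 \<or> a = 1 - 2 * c / s2"
  obtains A1 B where "A1 \<ge> exp 1" "B > 0"
    "\<And>x y. A1 \<le> x \<Longrightarrow> x \<le> y \<Longrightarrow> plog a (- 1) x \<le> plog a (- 1) y"
    "\<And>R t. t \<ge> 1 \<Longrightarrow> 0 \<le> R \<Longrightarrow> integrable M (\<lambda>\<omega>. indicator (below R t) \<omega> *
        (cut_plog a (- 1) A1 (X (t + 1) \<omega>) - cut_plog a (- 1) A1 (X t \<omega>)))"
    "\<And>R t. t \<ge> 1 \<Longrightarrow> 0 \<le> R \<Longrightarrow> (\<integral>\<omega>. indicator (below R t) \<omega> *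
        (cut_plog a (- 1) A1 (X (t + 1) \<omega>) - cut_plog a (- 1) A1 (X t \<omega>)) \<partial>M) \<le> B"
proof -
  obtain A1 A u v w where A: "A \<ge> x0" "A1 \<ge> exp 1" "A1 \<le> A"
    and mono: "\<And>x y. A1 \<le> x \<Longrightarrow> x \<le> y \<Longrightarrow> plog a (- 1) x \<le> plog a (- 1) y"
    and [measurable]: "u \<in> borel_measurable borel" "v \<in> borel_measurable borel" "w \<in> borel_measurable borel"
    and w: "\<And>x. w x \<ge> 0"
    and f_le: "\<And>x h. A \<le> x \<Longrightarrow> cut_plog a (- 1) A1 (x + h) - cut_plog a (- 1) A1 x
        \<le> u x * h + v x * h\<^sup>2 + w x * \<bar>h\<bar> powr p"
    and drift_le: "\<And>x \<mu> \<sigma>. A \<le> x \<Longrightarrow> \<bar>\<mu> - c / x\<bar> \<le> \<bar>h1 x\<bar> \<Longrightarrow> \<bar>\<sigma> - s2\<bar> \<le> \<bar>h2 x\<bar> \<Longrightarrow>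
        u x * \<mu> + v x * \<sigma> + w x * (C * (1 + x) powr (p - 2 - \<delta>)) \<le> 1"
    by (rule upper_test_function[OF h1 h2 \<delta>_pos C_nonneg s2_pos p_gt a, of x0]) blast
  define f where "f = cut_plog a (- 1) A1"
  have [measurable]: "f \<in> borel_measurable borel" unfolding f_def by measurable
  have f0: "0 \<le> f y" for y unfolding f_def by (rule cut_plog_nonneg)
  have fa: "f y \<le> \<bar>y\<bar> powr a" for y unfolding f_def using A by (intro cut_plog_le_powr)
  define e where "e = \<bar>p - 2 - \<delta>\<bar>"
  define B where "B = 1 + 2 powr a * (A powr a + 1) + 2 powr a * (C * (1 + A) powr e)"
  have step: "f (X (t + 1) \<omega>) \<le> 2 powr a * (R powr a + \<bar>\<Delta> t \<omega>\<bar> powr a)"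
    if "t \<ge> 1" "\<omega> \<in> space M" "X t \<omega> < R" for R t \<omega>
  proof -
    have "f (X (t + 1) \<omega>) \<le> \<bar>X (t + 1) \<omega>\<bar> powr a" by (rule fa)
    also have "\<dots> \<le> (R + \<bar>\<Delta> t \<omega>\<bar>) powr a"
      using X_nonneg[OF that(1,2)] X_nonneg[of "t + 1" \<omega>] that a by (intro powr_mono2) auto
    also have "\<dots> \<le> 2 powr a * (R powr a + \<bar>\<Delta> t \<omega>\<bar> powr a)"
      using X_nonneg[OF that(1,2)] that a by (intro powr_add_le) auto
    finally show ?thesis .
  qed
  have int: "integrable M (\<lambda>\<omega>. indicator G \<omega> * (f (X (t + 1) \<omega>) - f (X t \<omega>)))"
    "integrable M (\<lambda>\<omega>. indicator G \<omega> * f (X (t + 1) \<omega>))"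
    if t: "t \<ge> 1" and G: "G \<in> sets (F t)" "\<And>\<omega>. \<omega> \<in> G \<Longrightarrow> X t \<omega> < R" and R: "0 \<le> R" for G t R
  proof -
    have [measurable]: "X t \<in> borel_measurable M" "X (t + 1) \<in> borel_measurable M" using t by auto
    have GM: "\<omega> \<in> space M" if "\<omega> \<in> G" for \<omega>
      using that sets.sets_into_space[OF F_sets_M[OF t G(1)]] by blast
    define K where "K = 2 powr a * (R powr a + 1) + R powr a"
    have K0: "K \<ge> 0" by (simp add: K_def)
    have 1: "\<bar>f (X (t + 1) \<omega>) - f (X t \<omega>)\<bar> \<le> K * (1 + \<bar>\<Delta> t \<omega>\<bar> powr a) \<and> \<bar>f (X (t + 1) \<omega>)\<bar> \<le> K * (1 + \<bar>\<Delta> t \<omega>\<bar> powr a)"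
      if "\<omega> \<in> G" for \<omega>
    proof -
      have "f (X t \<omega>) \<le> \<bar>X t \<omega>\<bar> powr a" by (rule fa)
      also have "\<dots> \<le> R powr a" using X_nonneg[OF t GM[OF that]] G(2)[OF that] a by (intro powr_mono2) auto
      finally have "f (X t \<omega>) \<le> R powr a" .
      moreover have "f (X (t + 1) \<omega>) \<le> 2 powr a * (R powr a + \<bar>\<Delta> t \<omega>\<bar> powr a)"
        by (rule step[OF t GM[OF that] G(2)[OF that]])
      moreover have "2 powr a * (R powr a + \<bar>\<Delta> t \<omega>\<bar> powr a) + R powr a \<le> K * (1 + \<bar>\<Delta> t \<omega>\<bar> powr a)"
        by (simp add: K_def algebra_simps add_increasing)
      moreover have "0 \<le> R powr a" by simp
      ultimately show ?thesis using f0[of "X (t + 1) \<omega>"] f0[of "X t \<omega>"] by linarith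
    qed
    show "integrable M (\<lambda>\<omega>. indicator G \<omega> * (f (X (t + 1) \<omega>) - f (X t \<omega>)))"
      using 1 K0 a by (intro increment_integrable[OF t G, where q=a and K=K]) auto
    show "integrable M (\<lambda>\<omega>. indicator G \<omega> * f (X (t + 1) \<omega>))"
      using 1 K0 a by (intro increment_integrable[OF t G, where q=a and K=K]) auto
  qed
  have bound: "(\<integral>\<omega>. indicator (below R t) \<omega> * (f (X (t + 1) \<omega>) - f (X t \<omega>)) \<partial>M) \<le> B"
    if t: "t \<ge> 1" and R: "0 \<le> R" for R t
  proof -
    have [measurable]: "X t \<in> borel_measurable (F t)" "below R t \<in> sets (F t)"
      "X t \<in> borel_measurable M" "X (t + 1) \<in> borel_measurable M"
      using t adapted below_F by auto
    have sp: "space (F t) = space M" using F_sub[OF t] by (simp add: subalgebra_def)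
    define G1 where "G1 = below R t \<inter> {\<omega> \<in> space (F t). A \<le> X t \<omega>}"
    define G2 where "G2 = below R t \<inter> {\<omega> \<in> space (F t). X t \<omega> < A}"
    have G: "G1 \<in> sets (F t)" "G2 \<in> sets (F t)" unfolding G1_def G2_def by measurable
    have GM [measurable]: "G1 \<in> sets M" "G2 \<in> sets M" using G F_sets_M[OF t] by auto
    have bR: "\<And>\<omega>. \<omega> \<in> below R t \<Longrightarrow> X t \<omega> < R" using t by (auto simp: below_def)
    have split: "indicator (below R t) \<omega> = (indicator G1 \<omega> + indicator G2 \<omega> :: real)" for \<omega>
      by (auto simp: G1_def G2_def indicator_def below_def sp)
    have i1: "integrable M (\<lambda>\<omega>. indicator G1 \<omega> * (f (X (t + 1) \<omega>) - f (X t \<omega>)))"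
      by (rule int[OF t G(1) _ R]) (auto simp: G1_def bR)
    have i2: "integrable M (\<lambda>\<omega>. indicator G2 \<omega> * (f (X (t + 1) \<omega>) - f (X t \<omega>)))"
      by (rule int[OF t G(2) _ R]) (auto simp: G2_def bR)
    have "(-1) * prob G1 \<le> (\<integral>\<omega>. indicator G1 \<omega> * (f (X t \<omega>) - f (X (t + 1) \<omega>)) \<partial>M)"
    proof (rule drift_ge[OF t G(1), where A=A and R=R and u="\<lambda>x. - u x" and v="\<lambda>x. - v x" and w=w])
      show "integrable M (\<lambda>\<omega>. indicator G1 \<omega> * (f (X t \<omega>) - f (X (t + 1) \<omega>)))"
        using Bochner_Integration.integrable_minus[OF i1] by (simp add: algebra_simps)
      show "- u (X t \<omega>) * \<Delta> t \<omega> + - v (X t \<omega>) * (\<Delta> t \<omega>)\<^sup>2 - w (X t \<omega>) * \<bar>\<Delta> t \<omega>\<bar> powr p \<le> f (X t \<omega>) - f (X (t + 1) \<omega>)"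
        if "\<omega> \<in> G1" for \<omega>
        using f_le[of "X t \<omega>" "\<Delta> t \<omega>"] that by (simp add: G1_def f_def)
      show "- 1 \<le> - u x * \<mu> + - v x * \<sigma> - w x * (C * (1 + x) powr (p - 2 - \<delta>))"
        if "A \<le> x" "\<bar>\<mu> - c / x\<bar> \<le> \<bar>h1 x\<bar>" "\<bar>\<sigma> - s2\<bar> \<le> \<bar>h2 x\<bar>" for x \<mu> \<sigma>
        using drift_le[OF that] by simp
    qed (use w A bR in \<open>auto simp: G1_def\<close>)
    moreover have "(\<integral>\<omega>. indicator G1 \<omega> * (f (X t \<omega>) - f (X (t + 1) \<omega>)) \<partial>M)
        = - (\<integral>\<omega>. indicator G1 \<omega> * (f (X (t + 1) \<omega>) - f (X t \<omega>)) \<partial>M)"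
      by (subst Bochner_Integration.integral_minus[symmetric]) (simp add: algebra_simps)
    ultimately have 1: "(\<integral>\<omega>. indicator G1 \<omega> * (f (X (t + 1) \<omega>) - f (X t \<omega>)) \<partial>M) \<le> 1"
      using prob_le_1[of G1] by linarith
    have G2A: "\<And>\<omega>. \<omega> \<in> G2 \<Longrightarrow> X t \<omega> < A" by (auto simp: G2_def)
    define k where "k = 2 powr a * (A powr a + 1)"
    note mo = moment_on[OF t G(2) G2A, of "\<lambda>_. 2 powr a", simplified]
    have "(\<integral>\<omega>. indicator G2 \<omega> * (f (X (t + 1) \<omega>) - f (X t \<omega>)) \<partial>M)
      \<le> (\<integral>\<omega>. k + indicator G2 \<omega> * 2 powr a * \<bar>\<Delta> t \<omega>\<bar> powr p \<partial>M)"
    proof (rule integral_mono_AE[OF i2])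
      show "integrable M (\<lambda>\<omega>. k + indicator G2 \<omega> * 2 powr a * \<bar>\<Delta> t \<omega>\<bar> powr p)" using mo(1) by simp
      show "AE \<omega> in M. indicator G2 \<omega> * (f (X (t + 1) \<omega>) - f (X t \<omega>)) \<le> k + indicator G2 \<omega> * 2 powr a * \<bar>\<Delta> t \<omega>\<bar> powr p"
      proof (rule AE_I2)
        fix \<omega> assume \<omega>: "\<omega> \<in> space M"
        show "indicator G2 \<omega> * (f (X (t + 1) \<omega>) - f (X t \<omega>)) \<le> k + indicator G2 \<omega> * 2 powr a * \<bar>\<Delta> t \<omega>\<bar> powr p"
        proof (cases "\<omega> \<in> G2")
          case True
          have "\<bar>\<Delta> t \<omega>\<bar> powr a \<le> 1 + \<bar>\<Delta> t \<omega>\<bar> powr p"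
            using a by (intro powr_le_one_add_powr) auto
          then have "2 powr a * (A powr a + \<bar>\<Delta> t \<omega>\<bar> powr a) \<le> 2 powr a * (A powr a + (1 + \<bar>\<Delta> t \<omega>\<bar> powr p))"
            by (intro mult_left_mono) auto
          with step[OF t \<omega> G2A[OF True]] f0[of "X t \<omega>"] True show ?thesis
            by (simp add: k_def algebra_simps)
        qed (simp add: k_def)
      qed
    qed
    also have "\<dots> = k + (\<integral>\<omega>. indicator G2 \<omega> * 2 powr a * \<bar>\<Delta> t \<omega>\<bar> powr p \<partial>M)"
      using mo(1) by (simp add: prob_space)
    also have "\<dots> \<le> k + (\<integral>\<omega>. indicator G2 \<omega> * 2 powr a * (C * (1 + X t \<omega>) powr (p - 2 - \<delta>)) \<partial>M)"
      using mo(3) by simp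
    also have "\<dots> \<le> k + (\<integral>\<omega>. 2 powr a * (C * (1 + A) powr e) \<partial>M)"
    proof (intro add_left_mono integral_mono_AE)
      show "AE \<omega> in M. indicator G2 \<omega> * 2 powr a * (C * (1 + X t \<omega>) powr (p - 2 - \<delta>)) \<le> 2 powr a * (C * (1 + A) powr e)"
      proof (rule AE_I2)
        fix \<omega> assume \<omega>: "\<omega> \<in> space M"
        show "indicator G2 \<omega> * 2 powr a * (C * (1 + X t \<omega>) powr (p - 2 - \<delta>)) \<le> 2 powr a * (C * (1 + A) powr e)"
        proof (cases "\<omega> \<in> G2")
          case True
          have "(1 + X t \<omega>) powr (p - 2 - \<delta>) \<le> (1 + X t \<omega>) powr e"
            using X_nonneg[OF t \<omega>] by (intro powr_mono) (auto simp: e_def)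
          also have "\<dots> \<le> (1 + A) powr e"
            using X_nonneg[OF t \<omega>] G2A[OF True] by (intro powr_mono2) (auto simp: e_def)
          finally have "2 powr a * (C * (1 + X t \<omega>) powr (p - 2 - \<delta>)) \<le> 2 powr a * (C * (1 + A) powr e)"
            using C_nonneg by (intro mult_left_mono) auto
          then show ?thesis using True by simp
        qed (use C_nonneg in simp)
      qed
    qed (use mo(2) in auto)
    also have "\<dots> = k + 2 powr a * (C * (1 + A) powr e)" by (simp add: prob_space)
    finally have 2: "(\<integral>\<omega>. indicator G2 \<omega> * (f (X (t + 1) \<omega>) - f (X t \<omega>)) \<partial>M) \<le> k + 2 powr a * (C * (1 + A) powr e)" .
    have "(\<integral>\<omega>. indicator (below R t) \<omega> * (f (X (t + 1) \<omega>) - f (X t \<omega>)) \<partial>M)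
       = (\<integral>\<omega>. indicator G1 \<omega> * (f (X (t + 1) \<omega>) - f (X t \<omega>)) \<partial>M)
         + (\<integral>\<omega>. indicator G2 \<omega> * (f (X (t + 1) \<omega>) - f (X t \<omega>)) \<partial>M)"
      unfolding split distrib_right using i1 i2 by (rule Bochner_Integration.integral_add)
    with 1 2 show ?thesis by (simp add: B_def k_def)
  qed
  show ?thesis
  proof (rule that[of A1 B])
    show "A1 \<ge> exp 1" by fact
    show "B > 0" unfolding B_def using C_nonneg by (intro add_pos_nonneg) auto
    show "\<And>x y. A1 \<le> x \<Longrightarrow> x \<le> y \<Longrightarrow> plog a (- 1) x \<le> plog a (- 1) y" by fact
  next
    fix R :: real and t :: nat assume "t \<ge> 1" "0 \<le> R"
    then show "integrable M (\<lambda>\<omega>. indicator (below R t) \<omega> *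
        (cut_plog a (- 1) A1 (X (t + 1) \<omega>) - cut_plog a (- 1) A1 (X t \<omega>)))"
      "(\<integral>\<omega>. indicator (below R t) \<omega> *
        (cut_plog a (- 1) A1 (X (t + 1) \<omega>) - cut_plog a (- 1) A1 (X t \<omega>)) \<partial>M) \<le> B"
      using int(1)[of t "below R t" R] bound[of t R] below_F[of t R] unfolding f_def by (auto simp: below_def)
  qed
qed

lemma max_tail_upper:
  assumes a: "2 \<le> a" "a \<le> p" "a = 2 \<or> a = 1 - 2 * c / s2"
  obtains B R0 where "B > 0" "\<And>R n. R \<ge> R0 \<Longrightarrow> n \<ge> 1 \<Longrightarrow> plog a (- 1) R * prob (space M - below R n) \<le> B * real n"
proof -
  obtain A1 B where A1: "A1 \<ge> exp 1" "B > 0"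
    and mono: "\<And>x y. A1 \<le> x \<Longrightarrow> x \<le> y \<Longrightarrow> plog a (- 1) x \<le> plog a (- 1) y"
    and int: "\<And>R t. t \<ge> 1 \<Longrightarrow> 0 \<le> R \<Longrightarrow> integrable M (\<lambda>\<omega>. indicator (below R t) \<omega> *
        (cut_plog a (- 1) A1 (X (t + 1) \<omega>) - cut_plog a (- 1) A1 (X t \<omega>)))"
    and bound: "\<And>R t. t \<ge> 1 \<Longrightarrow> 0 \<le> R \<Longrightarrow> (\<integral>\<omega>. indicator (below R t) \<omega> *
        (cut_plog a (- 1) A1 (X (t + 1) \<omega>) - cut_plog a (- 1) A1 (X t \<omega>)) \<partial>M) \<le> B"
    by (rule one_step_cut_plog[OF a]) blast
  define f where "f = cut_plog a (- 1) A1"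
  have A10: "A1 > 0" using A1 exp_gt_zero[of "1::real"] by linarith
  show ?thesis
  proof (rule that[of B A1])
    fix R :: real and n :: nat assume R: "R \<ge> A1" and n: "n \<ge> 1"
    then obtain N where N: "n = Suc N" by (cases n) auto
    have R0: "R \<ge> 0" using R A10 by linarith
    have "plog a (- 1) R * prob (space M - below R n) = (\<integral>\<omega>. plog a (- 1) R * indicator (space M - below R n) \<omega> \<partial>M)"
      by simp
    also have "\<dots> \<le> (\<integral>\<omega>. (\<Sum>t=1..N. indicator (below R t) \<omega> * (f (X (t + 1) \<omega>) - f (X t \<omega>))) \<partial>M)"
    proof (rule integral_mono_AE)
      show "integrable M (\<lambda>\<omega>. \<Sum>t=1..N. indicator (below R t) \<omega> * (f (X (t + 1) \<omega>) - f (X t \<omega>)))"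
        unfolding f_def using R0 by (intro Bochner_Integration.integrable_sum int) auto
      show "AE \<omega> in M. plog a (- 1) R * indicator (space M - below R n) \<omega>
          \<le> (\<Sum>t=1..N. indicator (below R t) \<omega> * (f (X (t + 1) \<omega>) - f (X t \<omega>)))"
        using X_1 AE_space
      proof eventually_elim
        case (elim \<omega>)
        have eq: "(\<Sum>t=1..N. indicator (below R t) \<omega> * (f (X (t + 1) \<omega>) - f (X t \<omega>)))
          = (\<Sum>t=1..N. if \<forall>s\<in>{1..t}. X s \<omega> < R then f (X (t + 1) \<omega>) - f (X t \<omega>) else 0)"
          using elim by (intro sum.cong) (auto simp: below_def indicator_def)
        obtain j where j: "j \<ge> 1"
          "(\<Sum>t=1..N. if \<forall>s\<in>{1..t}. X s \<omega> < R then f (X (t + 1) \<omega>) - f (X t \<omega>) else 0) = f (X j \<omega>) - f (X 1 \<omega>)"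
          "if \<forall>s\<in>{1..Suc N}. X s \<omega> < R then j = Suc N else X j \<omega> \<ge> R"
          using telescope_stopped[where n=N and x="\<lambda>t. X t \<omega>" and R=R and f=f] by blast
        have f1: "f (X 1 \<omega>) = 0" using elim A10 by (simp add: f_def cut_plog_def)
        show ?case
        proof (cases "\<omega> \<in> below R n")
          case True
          then show ?thesis unfolding eq j(2) f1 by (simp add: f_def cut_plog_nonneg)
        next
          case False
          then have "\<not> (\<forall>s\<in>{1..Suc N}. X s \<omega> < R)" using elim by (auto simp: below_def N)
          then have "X j \<omega> \<ge> R" using j(3) by (simp only: if_False)
          then have "plog a (- 1) R \<le> f (X j \<omega>)" using R mono by (simp add: f_def cut_plog_def)
          then show ?thesis unfolding eq j(2) f1 using False elim by simp
        qed
      qed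
    qed (auto intro!: integrable_real_indicator simp: less_top[symmetric])
    also have "\<dots> = (\<Sum>t=1..N. (\<integral>\<omega>. indicator (below R t) \<omega> * (f (X (t + 1) \<omega>) - f (X t \<omega>)) \<partial>M))"
      unfolding f_def using R0 by (intro Bochner_Integration.integral_sum int) auto
    also have "\<dots> \<le> (\<Sum>t=1..N. B)"
      unfolding f_def using R0 by (intro sum_mono bound) auto
    also have "\<dots> \<le> B * real n" using A1 N by (simp add: mult.commute mult_left_mono)
    finally show "plog a (- 1) R * prob (space M - below R n) \<le> B * real n" .
  qed fact
qed

lemma trunc_plog_visits:
  assumes a: "2 \<le> a" "1 - 2 * c / s2 \<le> a" "b > 0" "2 < a \<or> b = 1"
  obtains A \<kappa> where "A > 1" "\<kappa> > 0"
    "\<And>R n. R \<ge> A \<Longrightarrow> \<kappa> * (\<Sum>t=1..n. prob (below R t \<inter> {\<omega> \<in> space M. A \<le> X t \<omega>})) \<le> plog a b (2 * R)"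
proof -
  obtain A \<kappa> u v w where A: "A \<ge> x0" "A > 1" "\<kappa> > 0"
    and [measurable]: "u \<in> borel_measurable borel" "v \<in> borel_measurable borel" "w \<in> borel_measurable borel"
    and w: "\<And>x. w x \<ge> (0::real)"
    and f_ge: "\<And>x h R. A \<le> x \<Longrightarrow> x < R \<Longrightarrow> u x * h + v x * h\<^sup>2 - w x * \<bar>h\<bar> powr p
        \<le> trunc_plog a b A R (x + h) - trunc_plog a b A R x"
    and drift_ge': "\<And>x \<mu> \<sigma>. A \<le> x \<Longrightarrow> \<bar>\<mu> - c / x\<bar> \<le> \<bar>h1 x\<bar> \<Longrightarrow> \<bar>\<sigma> - s2\<bar> \<le> \<bar>h2 x\<bar> \<Longrightarrow>
        \<kappa> \<le> u x * \<mu> + v x * \<sigma> - w x * (C * (1 + x) powr (p - 2 - \<delta>))"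
    by (rule lower_test_function[OF h1 h2 \<delta>_pos C_nonneg s2_pos p_gt a, of x0]) blast
  show ?thesis
  proof (rule that[of A \<kappa>])
    fix R :: real and n :: nat assume R: "R \<ge> A"
    define f where "f = trunc_plog a b A R"
    have [measurable]: "f \<in> borel_measurable borel" unfolding f_def by measurable
    have f0: "0 \<le> f y" and f1: "f y \<le> plog a b (2 * R)" for y
      unfolding f_def using trunc_plog_bounds[of a b A R y] a A R by auto
    have int: "integrable M (\<lambda>\<omega>. indicator G \<omega> * (f (X (t + 1) \<omega>) - f (X t \<omega>)))"
      if t: "t \<ge> 1" and G: "G \<in> sets M" for G t
    proof (rule integrable_const_bound[of _ "plog a b (2 * R)"])
      have [measurable]: "X t \<in> borel_measurable M" "X (t + 1) \<in> borel_measurable M" "G \<in> sets M" using t G by auto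
      show "AE \<omega> in M. norm (indicator G \<omega> * (f (X (t + 1) \<omega>) - f (X t \<omega>))) \<le> plog a b (2 * R)"
      proof (rule AE_I2)
        fix \<omega>
        show "norm (indicator G \<omega> * (f (X (t + 1) \<omega>) - f (X t \<omega>))) \<le> plog a b (2 * R)"
          using f0[of "X t \<omega>"] f0[of "X (t + 1) \<omega>"] f1[of "X t \<omega>"] f1[of "X (t + 1) \<omega>"] plog_nonneg[of a b "2 * R"]
          by (auto simp: indicator_def)
      qed
      show "(\<lambda>\<omega>. indicator G \<omega> * (f (X (t + 1) \<omega>) - f (X t \<omega>))) \<in> borel_measurable M" by measurable
    qed
    have step: "\<kappa> * prob (below R t \<inter> {\<omega> \<in> space M. A \<le> X t \<omega>})
        \<le> (\<integral>\<omega>. indicator (below R t) \<omega> * (f (X (t + 1) \<omega>) - f (X t \<omega>)) \<partial>M)" if t: "t \<ge> 1" for t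
    proof -
      have [measurable]: "X t \<in> borel_measurable (F t)" "below R t \<in> sets (F t)"
        "X t \<in> borel_measurable M" "X (t + 1) \<in> borel_measurable M"
        using t adapted below_F by auto
      have sp: "space (F t) = space M" using F_sub[OF t] by (simp add: subalgebra_def)
      define G where "G = below R t \<inter> {\<omega> \<in> space (F t). A \<le> X t \<omega>}"
      have G: "G \<in> sets (F t)" unfolding G_def by measurable
      have [measurable]: "G \<in> sets M" using G F_sets_M[OF t] by auto
      have bR: "\<And>\<omega>. \<omega> \<in> below R t \<Longrightarrow> X t \<omega> < R" using t by (auto simp: below_def)
      have "\<kappa> * prob G \<le> (\<integral>\<omega>. indicator G \<omega> * (f (X (t + 1) \<omega>) - f (X t \<omega>)) \<partial>M)"
      proof (rule drift_ge[OF t G, where A=A and R=R and u=u and v=v and w=w])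
        show "integrable M (\<lambda>\<omega>. indicator G \<omega> * (f (X (t + 1) \<omega>) - f (X t \<omega>)))"
          by (rule int[OF t]) measurable
        show "u (X t \<omega>) * \<Delta> t \<omega> + v (X t \<omega>) * (\<Delta> t \<omega>)\<^sup>2 - w (X t \<omega>) * \<bar>\<Delta> t \<omega>\<bar> powr p \<le> f (X (t + 1) \<omega>) - f (X t \<omega>)"
          if "\<omega> \<in> G" for \<omega>
          using f_ge[of "X t \<omega>" R "\<Delta> t \<omega>"] that bR by (simp add: G_def f_def)
        show "\<kappa> \<le> u x * \<mu> + v x * \<sigma> - w x * (C * (1 + x) powr (p - 2 - \<delta>))"
          if "A \<le> x" "\<bar>\<mu> - c / x\<bar> \<le> \<bar>h1 x\<bar>" "\<bar>\<sigma> - s2\<bar> \<le> \<bar>h2 x\<bar>" for x \<mu> \<sigma>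
          using drift_ge'[OF that] .
      qed (use w A bR in \<open>auto simp: G_def\<close>)
      also have "\<dots> \<le> (\<integral>\<omega>. indicator (below R t) \<omega> * (f (X (t + 1) \<omega>) - f (X t \<omega>)) \<partial>M)"
      proof (rule integral_mono_AE)
        show "AE \<omega> in M. indicator G \<omega> * (f (X (t + 1) \<omega>) - f (X t \<omega>)) \<le> indicator (below R t) \<omega> * (f (X (t + 1) \<omega>) - f (X t \<omega>))"
        proof (rule AE_I2)
          fix \<omega> assume \<omega>: "\<omega> \<in> space M"
          have "f (X t \<omega>) = 0" if "\<not> A \<le> X t \<omega>" using that by (simp add: f_def trunc_plog_def)
          then show "indicator G \<omega> * (f (X (t + 1) \<omega>) - f (X t \<omega>)) \<le> indicator (below R t) \<omega> * (f (X (t + 1) \<omega>) - f (X t \<omega>))"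
            using f0[of "X (t + 1) \<omega>"] \<omega> by (auto simp: indicator_def G_def sp)
        qed
      qed (rule int[OF t]; measurable)+
      finally show ?thesis by (simp add: G_def sp)
    qed
    have "\<kappa> * (\<Sum>t=1..n. prob (below R t \<inter> {\<omega> \<in> space M. A \<le> X t \<omega>}))
        \<le> (\<Sum>t=1..n. (\<integral>\<omega>. indicator (below R t) \<omega> * (f (X (t + 1) \<omega>) - f (X t \<omega>)) \<partial>M))"
      unfolding sum_distrib_left by (intro sum_mono step) auto
    also have "\<dots> = (\<integral>\<omega>. (\<Sum>t=1..n. indicator (below R t) \<omega> * (f (X (t + 1) \<omega>) - f (X t \<omega>))) \<partial>M)"
      by (intro Bochner_Integration.integral_sum[symmetric] int) auto
    also have "\<dots> \<le> (\<integral>\<omega>. plog a b (2 * R) \<partial>M)"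
    proof (rule integral_mono_AE)
      show "AE \<omega> in M. (\<Sum>t=1..n. indicator (below R t) \<omega> * (f (X (t + 1) \<omega>) - f (X t \<omega>))) \<le> plog a b (2 * R)"
      proof (rule AE_I2)
        fix \<omega> assume \<omega>: "\<omega> \<in> space M"
        have eq: "(\<Sum>t=1..n. indicator (below R t) \<omega> * (f (X (t + 1) \<omega>) - f (X t \<omega>)))
          = (\<Sum>t=1..n. if \<forall>s\<in>{1..t}. X s \<omega> < R then f (X (t + 1) \<omega>) - f (X t \<omega>) else 0)"
          using \<omega> by (intro sum.cong) (auto simp: below_def indicator_def)
        obtain j where j:
          "(\<Sum>t=1..n. if \<forall>s\<in>{1..t}. X s \<omega> < R then f (X (t + 1) \<omega>) - f (X t \<omega>) else 0) = f (X j \<omega>) - f (X 1 \<omega>)"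
          using telescope_stopped[where n=n and x="\<lambda>t. X t \<omega>" and R=R and f=f] by blast
        show "(\<Sum>t=1..n. indicator (below R t) \<omega> * (f (X (t + 1) \<omega>) - f (X t \<omega>))) \<le> plog a b (2 * R)"
          unfolding eq j using f0[of "X 1 \<omega>"] f1[of "X j \<omega>"] by linarith
      qed
      show "integrable M (\<lambda>\<omega>. \<Sum>t=1..n. indicator (below R t) \<omega> * (f (X (t + 1) \<omega>) - f (X t \<omega>)))"
        by (intro Bochner_Integration.integrable_sum int) auto
    qed simp
    also have "\<dots> = plog a b (2 * R)" by (simp add: prob_space)
    finally show "\<kappa> * (\<Sum>t=1..n. prob (below R t \<inter> {\<omega> \<in> space M. A \<le> X t \<omega>})) \<le> plog a b (2 * R)" .
  qed (use A in auto)
qed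

lemma irreducible_bound:
  assumes "y \<in> S"
  obtains m0 :: nat and \<phi>0 :: real where "\<phi>0 > 0"
    "\<And>t G. t \<ge> 1 \<Longrightarrow> G \<in> sets (F t) \<Longrightarrow> (\<And>\<omega>. \<omega> \<in> G \<Longrightarrow> X t \<omega> < A) \<Longrightarrow>
       \<phi>0 * prob G \<le> (\<Sum>j=1..m0. prob (G \<inter> {\<omega> \<in> space M. X (t + j) \<omega> = y}))"
proof -
  define I where "I = S \<inter> {..A}"
  have I: "finite I" unfolding I_def by (rule S_locfin)
  define m0 where "m0 = Max (insert 1 ((\<lambda>x. m x y) ` I))"
  define \<phi>0 where "\<phi>0 = Min (insert 1 ((\<lambda>x. \<phi> x y) ` I))"
  have m0: "m x y \<le> m0" if "x \<in> S" "x < A" for x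
    unfolding m0_def using I that by (intro Max_ge) (auto simp: I_def)
  have \<phi>0: "\<phi>0 \<le> \<phi> x y" if "x \<in> S" "x < A" for x
    unfolding \<phi>0_def using I that by (intro Min_le) (auto simp: I_def)
  show ?thesis
  proof (rule that[of \<phi>0 m0])
    show "\<phi>0 > 0" unfolding \<phi>0_def using I \<phi>_pos assms by (subst Min_gr_iff) (auto simp: I_def)
    fix t G assume t: "t \<ge> 1" and G: "G \<in> sets (F t)" and GA: "\<And>\<omega>. \<omega> \<in> G \<Longrightarrow> X t \<omega> < A"
    interpret sigma_finite_subalgebra M "F t" using sigma_finite_F[OF t] .
    have [measurable]: "X t \<in> borel_measurable M" "G \<in> sets (F t)" "G \<in> sets M" using t G F_sets_M by auto
    have Xt: "X (t + j) \<in> borel_measurable M" for j using t by simp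
    define Y where "Y \<omega> = X (t + m (X t \<omega>) y) \<omega>" for \<omega>
    have [measurable]: "Y \<in> borel_measurable M"
      unfolding Y_def
    proof (rule measurable_compose_countable'[where g="X t" and I=S and f="\<lambda>x \<omega>. X (t + m x y) \<omega>"])
      show "X t \<in> measurable M (count_space S)"
        using X_in_S[OF t] by (subst measurable_count_space_eq_countable[OF countable_S]) auto
    qed (use Xt countable_S in auto)
    define g where "g \<omega> = (indicator {\<omega>''. X (t + m (X t \<omega>'') y) \<omega>'' = y} \<omega> :: real)" for \<omega>
    have g_eq: "g = (\<lambda>\<omega>. if Y \<omega> = y then 1 else 0)" by (auto simp: g_def Y_def fun_eq_iff)
    have [measurable]: "g \<in> borel_measurable M" unfolding g_eq by measurable
    have ig: "integrable M (\<lambda>\<omega>. indicator G \<omega> * g \<omega>)"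
      by (rule integrable_const_bound[of _ 1]) (auto simp: g_eq indicator_def)
    note rc = real_cond_exp_intg[OF ig]
    have rc1: "integrable M (\<lambda>\<omega>. indicator G \<omega> * real_cond_exp M (F t) g \<omega>)"
      and rc2: "(\<integral>\<omega>. indicator G \<omega> * real_cond_exp M (F t) g \<omega> \<partial>M) = (\<integral>\<omega>. indicator G \<omega> * g \<omega> \<partial>M)"
      by (rule rc; measurable)+
    have [measurable]: "{\<omega> \<in> space M. X (t + j) \<omega> = y} \<in> sets M" for j
      using Xt[of j] by measurable
    have ii: "integrable M (indicator B :: 'a \<Rightarrow> real)" if "B \<in> sets M" for B
      using that by (auto intro!: integrable_real_indicator simp: less_top[symmetric])
    have "\<phi>0 * prob G = (\<integral>\<omega>. \<phi>0 * indicator G \<omega> \<partial>M)" by simp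
    also have "\<dots> \<le> (\<integral>\<omega>. indicator G \<omega> * real_cond_exp M (F t) g \<omega> \<partial>M)"
    proof (rule integral_mono_AE)
      show "AE \<omega> in M. \<phi>0 * indicator G \<omega> \<le> indicator G \<omega> * real_cond_exp M (F t) g \<omega>"
        using irred[OF assms t] AE_space
      proof eventually_elim
        case (elim \<omega>)
        show ?case
        proof (cases "\<omega> \<in> G")
          case True
          have "\<phi>0 \<le> \<phi> (X t \<omega>) y" using True GA X_in_S[OF t elim(2)] by (intro \<phi>0) auto
          then show ?thesis using True elim(1) unfolding g_def by simp
        qed simp
      qed
    qed (use rc1 ii in auto)
    also have "\<dots> = (\<integral>\<omega>. indicator G \<omega> * g \<omega> \<partial>M)" by (rule rc2)
    also have "\<dots> \<le> (\<integral>\<omega>. (\<Sum>j=1..m0. indicator (G \<inter> {\<omega> \<in> space M. X (t + j) \<omega> = y}) \<omega>) \<partial>M)"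
    proof (rule integral_mono_AE)
      show "AE \<omega> in M. indicator G \<omega> * g \<omega> \<le> (\<Sum>j=1..m0. indicator (G \<inter> {\<omega> \<in> space M. X (t + j) \<omega> = y}) \<omega>)"
      proof (rule AE_I2)
        fix \<omega> assume \<omega>: "\<omega> \<in> space M"
        show "indicator G \<omega> * g \<omega> \<le> (\<Sum>j=1..m0. indicator (G \<inter> {\<omega> \<in> space M. X (t + j) \<omega> = y}) \<omega>)"
        proof (cases "\<omega> \<in> G \<and> Y \<omega> = y")
          case True
          define j where "j = m (X t \<omega>) y"
          have "j \<in> {1..m0}" using True GA X_in_S[OF t \<omega>] m0 m_ge assms by (auto simp: j_def)
          then have "indicator (G \<inter> {\<omega> \<in> space M. X (t + j) \<omega> = y}) \<omega> \<le>
            (\<Sum>j=1..m0. indicator (G \<inter> {\<omega> \<in> space M. X (t + j) \<omega> = y}) \<omega> :: real)"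
            by (intro member_le_sum) auto
          then show ?thesis using True \<omega> by (simp add: g_eq Y_def j_def)
        next
          case False
          then have z: "indicator G \<omega> * g \<omega> = 0" by (auto simp: g_eq)
          show ?thesis unfolding z by (simp add: sum_nonneg)
        qed
      qed
    qed (use ig in \<open>auto intro!: Bochner_Integration.integrable_sum ii\<close>)
    also have "\<dots> = (\<Sum>j=1..m0. (\<integral>\<omega>. indicator (G \<inter> {\<omega> \<in> space M. X (t + j) \<omega> = y}) \<omega> \<partial>M))"
      by (intro Bochner_Integration.integral_sum ii) auto
    also have "\<dots> = (\<Sum>j=1..m0. prob (G \<inter> {\<omega> \<in> space M. X (t + j) \<omega> = y}))"
      by (intro sum.cong refl) (auto simp: Int_absorb2 dest: sets.sets_into_space)
    finally show "\<phi>0 * prob G \<le> (\<Sum>j=1..m0. prob (G \<inter> {\<omega> \<in> space M. X (t + j) \<omega> = y}))" .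
  qed
qed

lemma max_tail_lower:
  assumes a: "2 \<le> a" "1 - 2 * c / s2 \<le> a" "b > 0" "2 < a \<or> b = 1"
  obtains K R0 where "\<And>R n. R \<ge> R0 \<Longrightarrow> n \<ge> 1 \<Longrightarrow> real n * prob (below R n) \<le> K * plog a b (2 * R)"
proof -
  obtain A \<kappa> where A: "A > 1" "\<kappa> > 0"
    and visits: "\<And>R n. R \<ge> A \<Longrightarrow> \<kappa> * (\<Sum>t=1..n. prob (below R t \<inter> {\<omega> \<in> space M. A \<le> X t \<omega>})) \<le> plog a b (2 * R)"
    by (rule trunc_plog_visits[OF a]) blast
  obtain y where y: "y \<in> S" "A < y"
    using S_unbdd by (metis bdd_above.I not_le)
  obtain m0 \<phi>0 where \<phi>0: "\<phi>0 > 0"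
    and hit: "\<And>t G. t \<ge> 1 \<Longrightarrow> G \<in> sets (F t) \<Longrightarrow> (\<And>\<omega>. \<omega> \<in> G \<Longrightarrow> X t \<omega> < A) \<Longrightarrow>
       \<phi>0 * prob G \<le> (\<Sum>j=1..m0. prob (G \<inter> {\<omega> \<in> space M. X (t + j) \<omega> = y}))"
    by (rule irreducible_bound[OF y(1), of A]) blast
  show ?thesis
  proof (rule that[of "max A (exp 1)" "1 / \<kappa> + (m0 * (1 / \<kappa> + m0)) / \<phi>0"])
    fix R :: real and n :: nat assume R: "R \<ge> max A (exp 1)" and n: "n \<ge> 1"
    define \<Lambda> where "\<Lambda> = plog a b (2 * R)"
    have "2 * R \<ge> exp 1" using R exp_gt_zero[of "1::real"] by linarith
    then have "ln (2 * R) \<ge> 1" using R A by (subst ln_ge_iff) auto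
    then have \<Lambda>1: "\<Lambda> \<ge> 1 * 1" unfolding \<Lambda>_def plog_def using a A R
      by (intro mult_mono ge_one_powr_ge_zero) auto
    define L where "L t = below R t \<inter> {\<omega> \<in> space M. A \<le> X t \<omega>}" for t
    define H where "H t = below R t \<inter> {\<omega> \<in> space M. X t \<omega> < A}" for t
    have LM: "L t \<in> sets M" "H t \<in> sets M" if "t \<ge> 1" for t
      using that X_measurable[OF that] unfolding L_def H_def by measurable
    have HF: "H t \<in> sets (F t)" if "t \<ge> 1" for t
    proof -
      have sp: "space (F t) = space M" using F_sub[OF that] by (simp add: subalgebra_def)
      show ?thesis unfolding H_def sp[symmetric] using adapted[OF that] below_F[OF that] by measurable
    qed
    have Lsum: "(\<Sum>t=1..n. prob (L t)) \<le> \<Lambda> / \<kappa>" for n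
      using visits[of R n] R A by (simp add: L_def \<Lambda>_def field_simps)
    have Hsum: "(\<Sum>t=1..n. prob (H t)) \<le> m0 * (\<Lambda> / \<kappa> + m0) / \<phi>0"
    proof -
      have "\<phi>0 * (\<Sum>t=1..n. prob (H t)) \<le> (\<Sum>t=1..n. \<Sum>j=1..m0. prob (H t \<inter> {\<omega> \<in> space M. X (t + j) \<omega> = y}))"
        unfolding sum_distrib_left using HF by (intro sum_mono hit) (auto simp: H_def)
      also have "\<dots> \<le> (\<Sum>t=1..n. \<Sum>j=1..m0. prob (L (t + j)) + (prob (below R t) - prob (below R (t + j))))"
      proof (intro sum_mono)
        fix t j assume t: "t \<in> {1..n}" and j: "j \<in> {1..m0}"
        have [measurable]: "L (t + j) \<in> sets M" using t by (intro LM) auto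
        have "H t \<inter> {\<omega> \<in> space M. X (t + j) \<omega> = y} \<subseteq> L (t + j) \<union> (below R t - below R (t + j))"
          using y by (auto simp: H_def L_def)
        then have "prob (H t \<inter> {\<omega> \<in> space M. X (t + j) \<omega> = y}) \<le> prob (L (t + j) \<union> (below R t - below R (t + j)))"
          by (intro finite_measure_mono) auto
        also have "\<dots> \<le> prob (L (t + j)) + prob (below R t - below R (t + j))"
          by (intro measure_Un_le) auto
        also have "prob (below R t - below R (t + j)) = prob (below R t) - prob (below R (t + j))"
          by (intro finite_measure_Diff below_antimono) auto
        finally show "prob (H t \<inter> {\<omega> \<in> space M. X (t + j) \<omega> = y}) \<le> prob (L (t + j)) + (prob (below R t) - prob (below R (t + j)))" .
      qed
      also have "\<dots> = (\<Sum>j=1..m0. (\<Sum>t=1..n. prob (L (t + j))) + (\<Sum>t=1..n. prob (below R t) - prob (below R (t + j))))"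
        by (subst sum.swap) (simp add: sum.distrib)
      also have "\<dots> \<le> (\<Sum>j=1..m0. \<Lambda> / \<kappa> + m0)"
      proof (intro sum_mono add_mono)
        fix j assume j: "j \<in> {1..m0}"
        have "(\<Sum>t=1..n. prob (L (t + j))) = (\<Sum>t=1+j..n+j. prob (L t))"
          by (rule sum.shift_bounds_cl_nat_ivl[symmetric])
        also have "\<dots> \<le> (\<Sum>t=1..n+j. prob (L t))" by (intro sum_mono2) auto
        also have "\<dots> \<le> \<Lambda> / \<kappa>" by (rule Lsum)
        finally show "(\<Sum>t=1..n. prob (L (t + j))) \<le> \<Lambda> / \<kappa>" .
        have "(\<Sum>t=1..n. prob (below R t) - prob (below R (t + j))) \<le> j"
          by (rule sum_shift_diff_le) auto
        also have "real j \<le> m0" using j by simp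
        finally show "(\<Sum>t=1..n. prob (below R t) - prob (below R (t + j))) \<le> m0" .
      qed
      also have "\<dots> = m0 * (\<Lambda> / \<kappa> + m0)" by simp
      finally show ?thesis using \<phi>0 by (simp add: field_simps)
    qed
    have "real n * prob (below R n) = (\<Sum>t=1..n. prob (below R n))" by simp
    also have "\<dots> \<le> (\<Sum>t=1..n. prob (L t) + prob (H t))"
    proof (rule sum_mono)
      fix t assume t: "t \<in> {1..n}"
      have "below R n \<subseteq> L t \<union> H t"
        using below_antimono[of t n R] t by (auto simp: L_def H_def below_def)
      then have "prob (below R n) \<le> prob (L t \<union> H t)" using LM[of t] t by (intro finite_measure_mono) auto
      also have "\<dots> \<le> prob (L t) + prob (H t)" using LM[of t] t by (intro measure_Un_le) auto
      finally show "prob (below R n) \<le> prob (L t) + prob (H t)" .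
    qed
    also have "\<dots> \<le> \<Lambda> / \<kappa> + m0 * (\<Lambda> / \<kappa> + m0) / \<phi>0"
      using Lsum[of n] Hsum by (simp add: sum.distrib)
    also have "\<dots> \<le> \<Lambda> / \<kappa> + m0 * (\<Lambda> / \<kappa> + m0 * \<Lambda>) / \<phi>0"
      using \<Lambda>1 \<phi>0 by (intro add_left_mono divide_right_mono mult_left_mono) (auto simp: mult_le_cancel_left1)
    also have "\<dots> = (1 / \<kappa> + (m0 * (1 / \<kappa> + m0)) / \<phi>0) * \<Lambda>"
      using \<phi>0 A by (simp add: field_simps)
    finally show "real n * prob (below R n) \<le> (1 / \<kappa> + (m0 * (1 / \<kappa> + m0)) / \<phi>0) * plog a b (2 * R)"
      by (simp add: \<Lambda>_def)
  qed
qed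

lemma max_upper:
  assumes a: "2 \<le> a" "a \<le> p" "a = 2 \<or> a = 1 - 2 * c / s2" and q: "q * a > 2"
  shows "AE \<omega> in M. eventually (\<lambda>t. (MAX s\<in>{1..t}. X s \<omega>) \<le> real t powr (1 / a) * ln (real t) powr q) sequentially"
proof -
  obtain B R0 where B: "B > 0" "\<And>R n. R \<ge> R0 \<Longrightarrow> n \<ge> 1 \<Longrightarrow> plog a (- 1) R * prob (space M - below R n) \<le> B * real n"
    by (rule max_tail_upper[OF a]) blast
  have a0: "1 / a > 0" using a by simp
  define U where "U = plog (1 / a) q"
  obtain Y where mono: "\<And>x y. Y \<le> x \<Longrightarrow> x \<le> y \<Longrightarrow> U x \<le> U y"
    by (rule plog_mono_eventually[OF a0, of 0 q, folded U_def]) blast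
  define b where "b x = 2 * B * x / plog a (- 1) (U x)" for x
  have "b \<in> O(\<lambda>x. ln x powr (1 - q * a))"
    unfolding b_def U_def plog_def using a by real_asymp
  then have sb: "summable (\<lambda>j::nat. b (2 ^ (j + 0)))"
    using q by (intro summable_ln_powr_dyadic) auto
  have top: "filterlim (\<lambda>j::nat. 2 ^ j :: real) at_top sequentially" by real_asymp
  have "eventually (\<lambda>x. R0 \<le> U x \<and> 1 < U x) at_top"
  proof -
    have "filterlim U at_top at_top" unfolding U_def plog_def using a by real_asymp
    then have "eventually (\<lambda>x. max R0 2 \<le> U x) at_top" by (simp only: filterlim_at_top)
    then show ?thesis by (rule eventually_mono) auto
  qed
  from eventually_compose_filterlim[OF this top]
  have "eventually (\<lambda>j::nat. prob (space M - below (U (2 ^ j)) (2 ^ (j + 1))) \<le> b (2 ^ (j + 0))) sequentially"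
  proof eventually_elim
    case (elim j)
    have "plog a (- 1) (U (2 ^ j)) * prob (space M - below (U (2 ^ j)) (2 ^ (j + 1))) \<le> B * real (2 ^ (j + 1))"
      using elim by (intro B) auto
    moreover have "plog a (- 1) (U (2 ^ j)) > 0" using elim by (simp add: plog_def)
    ultimately show ?case by (simp add: b_def field_simps)
  qed
  from AE_eventually_in[OF below_M this sb]
  show ?thesis
  proof eventually_elim
    case (elim \<omega>)
    then have "eventually (\<lambda>j. \<forall>s\<in>{1..2 ^ (j + 1)}. X s \<omega> < U (2 ^ j)) sequentially"
      by eventually_elim (auto simp: below_def)
    from dyadic_max_le[OF mono this] show ?case by (simp add: U_def plog_def)
  qed
qed

lemma max_lower:
  assumes a: "2 \<le> a" "1 - 2 * c / s2 \<le> a" "b > 0" "2 < a \<or> b = 1" and q: "q * a > b + 1"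
  shows "AE \<omega> in M. eventually (\<lambda>t. real t powr (1 / a) * ln (real t) powr (- q) \<le> (MAX s\<in>{1..t}. X s \<omega>)) sequentially"
proof -
  obtain K R0 where K: "\<And>R n. R \<ge> R0 \<Longrightarrow> n \<ge> 1 \<Longrightarrow> real n * prob (below R n) \<le> K * plog a b (2 * R)"
    by (rule max_tail_lower[OF a]) blast
  have a0: "1 / a > 0" using a by simp
  define L where "L = plog (1 / a) (- q)"
  obtain Y where mono: "\<And>x y. Y \<le> x \<Longrightarrow> x \<le> y \<Longrightarrow> L x \<le> L y"
    by (rule plog_mono_eventually[OF a0, of 0 "- q", folded L_def]) blast
  define d where "d x = 2 * K * plog a b (2 * L x) / x" for x
  have "d \<in> O(\<lambda>x. ln x powr (b - q * a))"
    unfolding d_def L_def plog_def using a by real_asymp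
  then have sd: "summable (\<lambda>j::nat. d (2 ^ (j + 1)))"
    using q by (intro summable_ln_powr_dyadic) auto
  have top: "filterlim (\<lambda>j::nat. 2 ^ (j + 1) :: real) at_top sequentially" by real_asymp
  have "eventually (\<lambda>x. R0 \<le> L x) at_top"
  proof -
    have "filterlim L at_top at_top" unfolding L_def plog_def using a by real_asymp
    then show ?thesis by (auto simp: filterlim_at_top)
  qed
  from eventually_compose_filterlim[OF this top]
  have "eventually (\<lambda>j::nat. prob (space M - (space M - below (L (2 ^ (j + 1))) (2 ^ j))) \<le> d (2 ^ (j + 1))) sequentially"
  proof eventually_elim
    case (elim j)
    have "real (2 ^ j) * prob (below (L (2 ^ (j + 1))) (2 ^ j)) \<le> K * plog a b (2 * L (2 ^ (j + 1)))"
      using elim by (intro K) auto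
    moreover have "space M - (space M - below (L (2 ^ (j + 1))) (2 ^ j)) = below (L (2 ^ (j + 1))) (2 ^ j)"
      by (auto simp: below_def)
    ultimately show ?case by (simp add: d_def field_simps)
  qed
  from AE_eventually_in[OF _ this sd]
  have "AE \<omega> in M. eventually (\<lambda>j. \<omega> \<in> space M - below (L (2 ^ (j + 1))) (2 ^ j)) sequentially" by auto
  then show ?thesis
  proof eventually_elim
    case (elim \<omega>)
    then have "eventually (\<lambda>j. \<exists>s\<in>{1..2 ^ j}. L (2 ^ (j + 1)) \<le> X s \<omega>) sequentially"
      by eventually_elim (auto simp: below_def not_less)
    from dyadic_max_ge[OF mono this] show ?case by (simp add: L_def plog_def)
  qed
qed

end

theorem theorem2p7:
  fixes M :: "'a measure" and F :: "nat \<Rightarrow> 'a measure"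
    and X :: "nat \<Rightarrow> 'a \<Rightarrow> real" and S :: "real set" and c s2 :: real
  assumes prob: "prob_space M"
    (* (A0) *)
    and S_nonneg: "S \<subseteq> {0..}" and S_0: "0 \<in> S"
    and S_locfin: "\<And>b. finite (S \<inter> {..b})" and S_unbdd: "\<not> bdd_above S"
    and F_sub: "\<And>t. t \<ge> 1 \<Longrightarrow> subalgebra M (F t)"
    and F_mono: "\<And>s t. 1 \<le> s \<Longrightarrow> s \<le> t \<Longrightarrow> sets (F s) \<subseteq> sets (F t)"
    and adapted: "\<And>t. t \<ge> 1 \<Longrightarrow> X t \<in> borel_measurable (F t)"
    and X_in_S: "\<And>t \<omega>. t \<ge> 1 \<Longrightarrow> \<omega> \<in> space M \<Longrightarrow> X t \<omega> \<in> S"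
    and X_1: "AE \<omega> in M. X 1 \<omega> = 0"
    (* (A1) *)
    and A1: "\<exists>(m :: real \<Rightarrow> real \<Rightarrow> nat) (\<phi> :: real \<Rightarrow> real \<Rightarrow> real).
               (\<forall>x\<in>S. \<forall>y\<in>S. m x y \<ge> 1 \<and> \<phi> x y > 0) \<and>
               (\<forall>y\<in>S. \<forall>t\<ge>1. AE \<omega> in M.
                  real_cond_exp M (F t)
                    (\<lambda>\<omega>'. indicator {\<omega>''. X (t + m (X t \<omega>'') y) \<omega>'' = y} \<omega>') \<omega>
                  \<ge> \<phi> (X t \<omega>) y)"
    (* (A2) *)
    and s2_pos: "s2 > 0"
    and A2: "\<exists>h1 \<in> o[at_top](\<lambda>x::real. 1 / (x * ln x)). \<exists>h2 \<in> o[at_top](\<lambda>x::real. 1 / ln x).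
               \<exists>x0::real. \<forall>t\<ge>1. AE \<omega> in M. X t \<omega> \<ge> x0 \<longrightarrow>
                 \<bar>real_cond_exp M (F t) (\<lambda>\<omega>'. X (t+1) \<omega>' - X t \<omega>') \<omega> - c / X t \<omega>\<bar>
                    \<le> \<bar>h1 (X t \<omega>)\<bar> \<and>
                 \<bar>real_cond_exp M (F t) (\<lambda>\<omega>'. (X (t+1) \<omega>' - X t \<omega>')\<^sup>2) \<omega> - s2\<bar>
                    \<le> \<bar>h2 (X t \<omega>)\<bar>"
    (* (A3) *)
    and A3a: "emeasure M (all_excursions_finite M X) > 0 \<Longrightarrow>
               (let P = uniform_measure M (all_excursions_finite M X) in
                  prob_space.indep_vars P (\<lambda>_. Pi\<^sub>M UNIV (\<lambda>_. borel))
                    (\<lambda>n. excursion X (Suc n)) UNIV \<and>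
                  (\<forall>n. distr P (Pi\<^sub>M UNIV (\<lambda>_. borel)) (excursion X (Suc n))
                       = distr P (Pi\<^sub>M UNIV (\<lambda>_. borel)) (excursion X 1)))"
    and A3b: "\<And>n. measure M {\<omega> \<in> space M. tau X n \<omega> < \<infinity>} > 0 \<Longrightarrow>
               measure M {\<omega> \<in> space M. eta X (Suc n) \<omega> < \<infinity> \<and> tau X n \<omega> < \<infinity>}
                 / measure M {\<omega> \<in> space M. tau X n \<omega> < \<infinity>}
               = measure M {\<omega> \<in> space M. eta X 1 \<omega> < \<infinity>}"
  shows
    "(let r = - 2 * c / s2 in
       ((-1 < r \<and> r \<le> 1 \<and> (\<exists>p>2. moment_cond M F X p)) \<longrightarrow>
          (\<forall>\<epsilon>>0. AE \<omega> in M. eventually (\<lambda>t.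
             sqrt (real t) * ln (real t) powr (- (4 + r) / (1 + r) - \<epsilon>)
               \<le> (MAX s\<in>{1..t}. X s \<omega>) \<and>
             (MAX s\<in>{1..t}. X s \<omega>)
               \<le> sqrt (real t) * ln (real t) powr (3 / (1 + r) + \<epsilon>)) sequentially)) \<and>
       ((r > 1 \<and> (\<exists>p>1+r. moment_cond M F X p)) \<longrightarrow>
          (\<forall>\<epsilon>>0. AE \<omega> in M. eventually (\<lambda>t.
             real t powr (1 / (1 + r)) * ln (real t) powr (- 1 / (1 + r) - \<epsilon>)
               \<le> (MAX s\<in>{1..t}. X s \<omega>) \<and>
             (MAX s\<in>{1..t}. X s \<omega>)
               \<le> real t powr (1 / (1 + r)) * ln (real t) powr (2 / (1 + r) + \<epsilon>)) sequentially)))"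
proof -
  define r where "r = - 2 * c / s2"
  have r': "1 - 2 * c / s2 = 1 + r" by (simp add: r_def)
  interpret prob_space M by fact
  obtain m \<phi> where m\<phi>: "\<And>x y. x \<in> S \<Longrightarrow> y \<in> S \<Longrightarrow> m x y \<ge> (1::nat)" "\<And>x y. x \<in> S \<Longrightarrow> y \<in> S \<Longrightarrow> \<phi> x y > (0::real)"
    and irred: "\<And>y t. y \<in> S \<Longrightarrow> t \<ge> 1 \<Longrightarrow> AE \<omega> in M.
       real_cond_exp M (F t) (\<lambda>\<omega>'. indicator {\<omega>''. X (t + m (X t \<omega>'') y) \<omega>'' = y} \<omega>') \<omega> \<ge> \<phi> (X t \<omega>) y"
    using A1 by blast
  obtain h1 h2 x0 where h: "h1 \<in> o[at_top](\<lambda>x::real. 1 / (x * ln x))" "h2 \<in> o[at_top](\<lambda>x::real. 1 / ln x)"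
    and drift: "\<And>t. t \<ge> 1 \<Longrightarrow> AE \<omega> in M. X t \<omega> \<ge> x0 \<longrightarrow>
       \<bar>real_cond_exp M (F t) (\<lambda>\<omega>'. X (t+1) \<omega>' - X t \<omega>') \<omega> - c / X t \<omega>\<bar> \<le> \<bar>h1 (X t \<omega>)\<bar> \<and>
       \<bar>real_cond_exp M (F t) (\<lambda>\<omega>'. (X (t+1) \<omega>' - X t \<omega>')\<^sup>2) \<omega> - s2\<bar> \<le> \<bar>h2 (X t \<omega>)\<bar>"
    using A2 by blast
  have process: "\<exists>\<delta> C. lamperti_process M F X S c s2 p \<delta> C x0 h1 h2 m \<phi>" if p: "p > 2" and mc: "moment_cond M F X p" for p
  proof -
    obtain \<delta> C where \<delta>: "\<delta> > 0" and C: "\<And>t. t \<ge> 1 \<Longrightarrow> AE \<omega> in M.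
        nn_cond_exp M (F t) (\<lambda>\<omega>. ennreal (\<bar>X (t+1) \<omega> - X t \<omega>\<bar> powr p)) \<omega>
          \<le> ennreal (C * (1 + X t \<omega>) powr (p - 2 - \<delta>))"
      using mc unfolding moment_cond_def by blast
    have "lamperti_process M F X S c s2 p \<delta> \<bar>C\<bar> x0 h1 h2 m \<phi>"
    proof
      fix t :: nat assume "t \<ge> 1"
      from C[OF this] show "AE \<omega> in M.
        nn_cond_exp M (F t) (\<lambda>\<omega>. ennreal (\<bar>X (t+1) \<omega> - X t \<omega>\<bar> powr p)) \<omega>
          \<le> ennreal (\<bar>C\<bar> * (1 + X t \<omega>) powr (p - 2 - \<delta>))"
        by eventually_elim (auto elim!: order_trans intro!: ennreal_leI mult_right_mono)
    qed (fact S_nonneg S_locfin S_unbdd F_sub F_mono adapted X_in_S X_1 m\<phi> irred s2_pos h drift p \<delta> abs_ge_zero)+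
    then show ?thesis by blast
  qed
  have part1: "AE \<omega> in M. eventually (\<lambda>t.
             sqrt (real t) * ln (real t) powr (- (4 + r) / (1 + r) - \<epsilon>)
               \<le> (MAX s\<in>{1..t}. X s \<omega>) \<and>
             (MAX s\<in>{1..t}. X s \<omega>)
               \<le> sqrt (real t) * ln (real t) powr (3 / (1 + r) + \<epsilon>)) sequentially"
    if r: "-1 < r" "r \<le> 1" and p: "p > 2" "moment_cond M F X p" and \<epsilon>: "\<epsilon> > 0" for p \<epsilon>
  proof -
    obtain \<delta> C where "lamperti_process M F X S c s2 p \<delta> C x0 h1 h2 m \<phi>" using process[OF p] by blast
    then interpret lamperti_process M F X S c s2 p \<delta> C x0 h1 h2 m \<phi> .
    have "3 / (1 + r) \<ge> 3 / 2" "(4 + r) / (1 + r) \<ge> 1" using r by (auto simp: field_simps)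
    moreover have "(x + \<epsilon>) * 2 > 2" if "x \<ge> 1" for x using \<epsilon> that by simp
    ultimately have q: "(3 / (1 + r) + \<epsilon>) * 2 > 2" "((4 + r) / (1 + r) + \<epsilon>) * 2 > 1 + 1" by force+
    have e: "- ((4 + r) / (1 + r) + \<epsilon>) = - (4 + r) / (1 + r) - \<epsilon>" unfolding minus_divide_left[symmetric] by simp
    have "AE \<omega> in M. eventually (\<lambda>t. (MAX s\<in>{1..t}. X s \<omega>) \<le> real t powr (1 / 2) * ln (real t) powr (3 / (1 + r) + \<epsilon>)) sequentially"
      using p q by (intro max_upper) auto
    moreover have "AE \<omega> in M. eventually (\<lambda>t. real t powr (1 / 2) * ln (real t) powr (- ((4 + r) / (1 + r) + \<epsilon>)) \<le> (MAX s\<in>{1..t}. X s \<omega>)) sequentially"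
      using p q r by (intro max_lower[where b=1]) (auto simp: r')
    ultimately show ?thesis unfolding e
      by eventually_elim (simp add: powr_half_sqrt eventually_conj_iff)
  qed
  have part2: "AE \<omega> in M. eventually (\<lambda>t.
             real t powr (1 / (1 + r)) * ln (real t) powr (- 1 / (1 + r) - \<epsilon>)
               \<le> (MAX s\<in>{1..t}. X s \<omega>) \<and>
             (MAX s\<in>{1..t}. X s \<omega>)
               \<le> real t powr (1 / (1 + r)) * ln (real t) powr (2 / (1 + r) + \<epsilon>)) sequentially"
    if r: "1 < r" and p: "p > 1 + r" "moment_cond M F X p" and \<epsilon>: "\<epsilon> > 0" for p \<epsilon>
  proof -
    have "p > 2" using p r by simp
    then obtain \<delta> C where "lamperti_process M F X S c s2 p \<delta> C x0 h1 h2 m \<phi>" using process p by blast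
    then interpret lamperti_process M F X S c s2 p \<delta> C x0 h1 h2 m \<phi> .
    have q: "(2 / (1 + r) + \<epsilon>) * (1 + r) > 2" "(1 / (1 + r) + \<epsilon>) * (1 + r) > \<epsilon> + 1"
    proof -
      have "(2 / (1 + r) + \<epsilon>) * (1 + r) = 2 + \<epsilon> * (1 + r)" "(1 / (1 + r) + \<epsilon>) * (1 + r) = \<epsilon> + 1 + \<epsilon> * r"
        using r by (auto simp: field_simps)
      moreover have "\<epsilon> * (1 + r) > 0" "\<epsilon> * r > 0" using r \<epsilon> by auto
      ultimately show "(2 / (1 + r) + \<epsilon>) * (1 + r) > 2" "(1 / (1 + r) + \<epsilon>) * (1 + r) > \<epsilon> + 1" by linarith+
    qed
    have e: "- (1 / (1 + r) + \<epsilon>) = - 1 / (1 + r) - \<epsilon>" unfolding minus_divide_left[symmetric] by simp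
    have "AE \<omega> in M. eventually (\<lambda>t. (MAX s\<in>{1..t}. X s \<omega>) \<le> real t powr (1 / (1 + r)) * ln (real t) powr (2 / (1 + r) + \<epsilon>)) sequentially"
      using p q r by (intro max_upper) (auto simp: r')
    moreover have "AE \<omega> in M. eventually (\<lambda>t. real t powr (1 / (1 + r)) * ln (real t) powr (- (1 / (1 + r) + \<epsilon>)) \<le> (MAX s\<in>{1..t}. X s \<omega>)) sequentially"
      using p q r \<epsilon> by (intro max_lower[where b=\<epsilon>]) (auto simp: r')
    ultimately show ?thesis unfolding e
      by eventually_elim (simp add: eventually_conj_iff)
  qed
  show ?thesis
    unfolding Let_def r_def[symmetric] using part1 part2 by blast
qed

end
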